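(* Let $\mathcal{M}\subseteq\mathcal{E}$ be a smooth embedded Riemannian submanifold of a Euclidean space $\mathcal{E}$ with retraction $\mathrm{R}:T\mathcal{M}\to\mathcal{M}$, and let $\varphi:\mathcal{M}\to\mathbb{R}$ be continuous. Assume that $\partial_{\mathcal{M}}\varphi$ is locally bounded and that for all $\bar x\in\mathcal{M}$ there exist $\tilde\kappa>0$, $r>0$ and an open neighborhood $V\subseteq\mathcal{M}$ of $\bar x$ with $$\varphi(\mathrm{R}_x(\xi_x))-\big(\varphi(x)+\langle w,\xi_x\rangle\big)\le\tilde\kappa\|\xi_x\|^2$$ for all $x\in V$, all $\xi_x\in T_x\mathcal{M}$ with $\|\xi_x\|\le r$ and all $w\in\partial_{\mathcal{M}}\varphi(x)$. Let $\{x^k\}$ be an infinite sequence generated by the nonmonotone subgradient method (described in the context) with reference values $\{\mathcal{R}_k\}$, where for constants $a,b>0$ independent of $k$ one has $\langle w^k_{\mathcal{M}},d^k\rangle\le-a\|d^k\|^2$ and $\|w^k_{\mathcal{M}}\|\le b\|d^k\|$ for all $k$. Suppose that $\{x^k\}$ converges on some subsequence $\{x^k\}_{k\in K}$ to a limit point $x^*\in\mathcal{M}$ such that $\Phi:=\varphi+\delta_{\mathcal{M}}$ has the Kurdyka–Łojasiewicz property at $x^*$. Then the entire sequence $\{x^k\}$ converges to $x^*$. Further, if the corresponding desingularization function is given by $\chi(t)=ct^\theta$ for some $c>0$ and $\theta\in(0,1)$, then: (a) If $\theta\in[1/2,1)$, then $\{\mathcal{R}_k\}$ converges R-linearly to $\varphi(x^*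 )$ and $\{x^k\}$ converges R-linearly to $x^*$. (b) If $\theta\in(0,1/2)$, then there exist constants $\eta_1,\eta_2>0$ such that for all $k$ large enough $$\mathcal{R}_k-\varphi(x^* )\le\eta_1k^{-\frac{1}{1-2\theta}},\qquad \|x^k-x^*\|\le\eta_2k^{-\frac{\theta}{1-2\theta}}.$$
   Context: $\mathcal{E}$ is a Euclidean space (finite-dimensional real Hilbert space) with inner product $\langle\cdot,\cdot\rangle$ and norm $\|\cdot\|$; $\overline{\mathbb{R}}=(-\infty,+\infty]$; $\mathrm{dist}(x,S)=\inf_{y\in S}\|x-y\|$. A sequence $\{z^k\}$ converges R-linearly to $z^*$ if $\limsup_{k\to\infty}\|z^k-z^*\|^{1/k}<1$. Smooth embedded submanifold: $\mathcal{M}\subseteq\mathcal{E}$ such that around each $\bar x\in\mathcal{M}$ there are an open neighborhood $U\subseteq\mathcal{E}$ and a $\mathcal{C}^1$ map $F:U\to\mathbb{R}^m$ with $\nabla F(\bar x)$ of rank $m$ ($m=\dim\mathcal{E}-\dim\mathcal{M}$) and $\mathcal{M}\cap U=\{x\in U:F(x)=0\}$. $T_x\mathcal{M}=\ker DF(x)\subseteq\mathcal{E}$ carries the inner product inherited from $\mathcal{E}$; $T\mathcal{M}=\{(x,\xi):x\in\mathcal{M},\xi\in T_x\mathcal{M}\}$. Retraction: a map $\mathrm{R}:T\mathcal{M}\to\mathcal{M}$, globally defined and at least $\mathcal{C}^2$ (locally the restriction of a $\mathcal{C}^2$ map on an open subset of $\mathcal{E}\times\mathcal{E}$), such that $\mathrm{R}_x:=\mathrm{R}(x,\cdot)$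 satisfies $\mathrm{R}_x(0_x)=x$ and $D\mathrm{R}_x(0_x)=\mathrm{id}_{T_x\mathcal{M}}$ for all $x\in\mathcal{M}$. Subdifferentials: for $g:\mathcal{E}\to\overline{\mathbb{R}}$ and $g(x)<\infty$, $\hat\partial g(x)=\{v:\liminf_{y\to x,y\ne x}\frac{g(y)-g(x)-\langle v,y-x\rangle}{\|y-x\|}\ge0\}$, and the limiting subdifferential $\partial g(x)$ is the set of limits $v=\lim v^k$ with $v^k\in\hat\partial g(x^k)$, $x^k\to x$, $g(x^k)\to g(x)$. With $\delta_{\mathcal{M}}$ the indicator function of $\mathcal{M}$, $\Phi=\varphi+\delta_{\mathcal{M}}:\mathcal{E}\to\overline{\mathbb{R}}$ equals $\varphi$ on $\mathcal{M}$ and $+\infty$ elsewhere, and the projectional subdifferential is $\partial_{\mathcal{M}}\varphi(x)=\mathrm{proj}_{T_x\mathcal{M}}\partial\Phi(x)=\partial\Phi(x)\cap T_x\mathcal{M}$ for $x\in\mathcal{M}$. It is locally bounded if each point of $\mathcal{M}$ has a neighborhood $V$ in $\mathcal{M}$ with $\bigcup_{x\in V}\partial_{\mathcal{M}}\varphi(x)$ bounded. Kurdyka–Łojasiewicz (KL) property: a lower semicontinuous $g:\mathcal{E}\to\overline{\mathbb{R}}$ satisfies the KL property at $x^*$ with $\partial g(x^* )\ne\emptyset$ if there are $\eta>0$, a neighborhood $U\subset\mathcal{E}$ of $x^*$ and a continuous concave function $\chi:[0,\eta]\to[0,\infty)$ (desingularization function), continuously differentiable on $(0,\eta)$ with $\chi(0)=0$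 and $\chi'(t)>0$ on $(0,\eta)$, such that $\chi'(g(x)-g(x^* ))\,\mathrm{dist}(0,\partial g(x))\ge1$ for all $x\in U$ with $g(x^* )<g(x)<g(x^* )+\eta$. Nonmonotone subgradient method. Parameters: $x^0\in\mathcal{M}$, $0<\tau_{\min}\le\tau_{\max}<\infty$, $\sigma,\beta\in(0,1)$, $p_{\min}\in(0,1]$. Set $\mathcal{R}_0:=\varphi(x^0)$. For $k=0,1,2,\dots$: choose $w^k_{\mathcal{M}}\in\partial_{\mathcal{M}}\varphi(x^k)$; if $w^k_{\mathcal{M}}=0$, stop and return $x^k$. Otherwise choose $d^k\in T_{x^k}\mathcal{M}\setminus\{0\}$ satisfying $\langle w^k_{\mathcal{M}},d^k\rangle\le-a\|d^k\|^2$ and $\|w^k_{\mathcal{M}}\|\le b\|d^k\|$. Choose an initial $\tau_k\in[\tau_{\min},\tau_{\max}]$; while $\varphi(\mathrm{R}_{x^k}(\tau_kd^k))>\mathcal{R}_k+\sigma\tau_k\langle w^k_{\mathcal{M}},d^k\rangle$, replace $\tau_k$ by $\beta\tau_k$. With the accepted $\tau_k$ set $x^{k+1}:=\mathrm{R}_{x^k}(\tau_kd^k)$. Choose $p_{k+1}\in[p_{\min},1]$ and set $\mathcal{R}_{k+1}:=(1-p_{k+1})\mathcal{R}_k+p_{k+1}\varphi(x^{k+1})$. *)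

theory Defs
  imports "HOL-Analysis.Analysis"
begin

text \<open>
  A map into $\mathbb{R}^m$ with $m$ a natural number is given by its components
  \<open>F 0, \<dots>, F (m - 1)\<close>; \<open>G i\<close> is the gradient of \<open>F i\<close>.  The last conjunct says that
  the Jacobian at \<open>x\<close>, whose rows are the vectors \<open>G i x\<close>, has rank \<open>m\<close>.
\<close>

definition local_defining_map ::
  "'a::euclidean_space set \<Rightarrow> nat \<Rightarrow> 'a \<Rightarrow> 'a set \<Rightarrow> (nat \<Rightarrow> 'a \<Rightarrow> real) \<Rightarrow> (nat \<Rightarrow> 'a \<Rightarrow> 'a) \<Rightarrow> bool"
  where
  "local_defining_map M m x U F G \<longleftrightarrow>
     open U \<and> x \<in> U \<and>
     (\<forall>i<m. (\<forall>y\<in>U. GDERIV (F i) y :> G i y) \<and> continuous_on U (G i)) \<and>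
     M \<inter> U = {y \<in> U. \<forall>i<m. F i y = 0} \<and>
     dim ((\<lambda>i. G i x) ` {..<m}) = m"

definition embedded_submanifold :: "'a::euclidean_space set \<Rightarrow> bool" where
  "embedded_submanifold M \<longleftrightarrow>
     (\<exists>m. \<forall>x\<in>M. \<exists>U F G. local_defining_map M m x U F G)"

text \<open>
  For \<open>x \<in> M\<close> the kernel of the derivative at \<open>x\<close> is the same for all local defining maps
  at \<open>x\<close>, so the existential quantifier does not enlarge it.
\<close>

definition tangent_space :: "'a::euclidean_space set \<Rightarrow> 'a \<Rightarrow> 'a set" where
  "tangent_space M x =
     {v. \<exists>m U F G. local_defining_map M m x U F G \<and> (\<forall>i<m. v \<bullet> G i x = 0)}"

definition tangent_bundle :: "'a::euclidean_space set \<Rightarrow> ('a \<times> 'a) set" where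
  "tangent_bundle M = {(x, \<xi>). x \<in> M \<and> \<xi> \<in> tangent_space M x}"

definition C1_on :: "'a::real_normed_vector set \<Rightarrow> ('a \<Rightarrow> 'b::real_normed_vector) \<Rightarrow> bool" where
  "C1_on U f \<longleftrightarrow>
     (\<exists>f'. (\<forall>x\<in>U. (f has_derivative blinfun_apply (f' x)) (at x)) \<and> continuous_on U f')"

definition C2_on :: "'a::real_normed_vector set \<Rightarrow> ('a \<Rightarrow> 'b::real_normed_vector) \<Rightarrow> bool" where
  "C2_on U f \<longleftrightarrow>
     (\<exists>f'. (\<forall>x\<in>U. (f has_derivative blinfun_apply (f' x)) (at x)) \<and> C1_on U f')"

text \<open>
  Only the values of \<open>R\<close> on the tangent bundle matter.  The derivative of \<open>R x\<close> at \<open>0\<close> is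
  taken within the tangent space, the domain of \<open>R x\<close>.
\<close>

definition manifold_retraction ::
  "'a::euclidean_space set \<Rightarrow> ('a \<Rightarrow> 'a \<Rightarrow> 'a) \<Rightarrow> bool" where
  "manifold_retraction M R \<longleftrightarrow>
     (\<forall>(x, \<xi>) \<in> tangent_bundle M. R x \<xi> \<in> M) \<and>
     (\<forall>z \<in> tangent_bundle M. \<exists>W f. open W \<and> z \<in> W \<and> C2_on W f \<and>
        (\<forall>(y, \<zeta>) \<in> W \<inter> tangent_bundle M. R y \<zeta> = f (y, \<zeta>))) \<and>
     (\<forall>x\<in>M. R x 0 = x \<and> (R x has_derivative (\<lambda>h. h)) (at 0 within tangent_space M x))"

definition regular_subdifferential ::
  "('a::euclidean_space \<Rightarrow> ereal) \<Rightarrow> 'a \<Rightarrow> 'a set" where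
  "regular_subdifferential g x =
     {v. \<bar>g x\<bar> \<noteq> \<infinity> \<and>
         Liminf (at x) (\<lambda>y. (g y - g x - ereal (v \<bullet> (y - x))) / ereal (norm (y - x))) \<ge> 0}"

definition limiting_subdifferential ::
  "('a::euclidean_space \<Rightarrow> ereal) \<Rightarrow> 'a \<Rightarrow> 'a set" where
  "limiting_subdifferential g x =
     {v. \<bar>g x\<bar> \<noteq> \<infinity> \<and>
         (\<exists>X V. X \<longlonglongrightarrow> x \<and> (\<lambda>k. g (X k)) \<longlonglongrightarrow> g x \<and>
                (\<forall>k. V k \<in> regular_subdifferential g (X k)) \<and> V \<longlonglongrightarrow> v)}"

definition delta_ind :: "'a set \<Rightarrow> 'a \<Rightarrow> ereal" where
  "delta_ind M x = (if x \<in> M then 0 else \<infinity>)"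

text \<open>The function $\varphi + \delta_M$; values of \<open>\<phi>\<close> outside \<open>M\<close> are irrelevant.\<close>

definition extend_by_infty :: "'a set \<Rightarrow> ('a \<Rightarrow> real) \<Rightarrow> 'a \<Rightarrow> ereal" where
  "extend_by_infty M \<phi> x = ereal (\<phi> x) + delta_ind M x"

text \<open>On a linear subspace, \<^const>\<open>closest_point\<close> is the orthogonal projection.\<close>

definition proj_subdifferential ::
  "'a::euclidean_space set \<Rightarrow> ('a \<Rightarrow> real) \<Rightarrow> 'a \<Rightarrow> 'a set" where
  "proj_subdifferential M \<phi> x =
     closest_point (tangent_space M x) ` limiting_subdifferential (extend_by_infty M \<phi>) x"

definition locally_bounded_on ::
  "'a::euclidean_space set \<Rightarrow> ('a \<Rightarrow> 'a set) \<Rightarrow> bool" where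
  "locally_bounded_on M S \<longleftrightarrow>
     (\<forall>x\<in>M. \<exists>V. openin (top_of_set M) V \<and> x \<in> V \<and> bounded (\<Union>y\<in>V. S y))"

text \<open>
  Extended-valued, so that the distance to the empty set is \<open>\<infinity>\<close>
  (whereas \<^const>\<open>infdist\<close> would give \<open>0\<close>).
\<close>

definition set_dist :: "'a::real_normed_vector \<Rightarrow> 'a set \<Rightarrow> ereal" where
  "set_dist x S = (INF y\<in>S. ereal (norm (x - y)))"

text \<open>
  Lower semicontinuity of \<open>g\<close>, usually a standing assumption, is not part of the predicate.
\<close>

definition KL_with ::
  "('a::euclidean_space \<Rightarrow> ereal) \<Rightarrow> 'a \<Rightarrow> (real \<Rightarrow> real) \<Rightarrow> bool" where
  "KL_with g xs \<psi> \<longleftrightarrow>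
     limiting_subdifferential g xs \<noteq> {} \<and>
     (\<exists>\<eta> U \<psi>'. 0 < \<eta> \<and> open U \<and> xs \<in> U \<and>
        continuous_on {0..\<eta>} \<psi> \<and> concave_on {0..\<eta>} \<psi> \<and> (\<forall>t\<in>{0..\<eta>}. 0 \<le> \<psi> t) \<and> \<psi> 0 = 0 \<and>
        (\<forall>t\<in>{0<..<\<eta>}. (\<psi> has_real_derivative \<psi>' t) (at t) \<and> 0 < \<psi>' t) \<and>
        continuous_on {0<..<\<eta>} \<psi>' \<and>
        (\<forall>x\<in>U. g xs < g x \<and> g x < g xs + ereal \<eta> \<longrightarrow>
           ereal (\<psi>' (real_of_ereal (g x - g xs))) * set_dist 0 (limiting_subdifferential g x) \<ge> 1))"

definition KL_property :: "('a::euclidean_space \<Rightarrow> ereal) \<Rightarrow> 'a \<Rightarrow> bool" where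
  "KL_property g xs \<longleftrightarrow> (\<exists>\<psi>. KL_with g xs \<psi>)"

text \<open>
  \<open>t0\<close> is the initial trial stepsize and \<open>j\<close> the number of reductions made by the
  backtracking loop.
\<close>

definition backtracking_step ::
  "(real \<Rightarrow> bool) \<Rightarrow> real \<Rightarrow> real \<Rightarrow> real \<Rightarrow> real \<Rightarrow> bool" where
  "backtracking_step accept \<beta> \<tau>min \<tau>max \<tau> \<longleftrightarrow>
     (\<exists>t0 j. t0 \<in> {\<tau>min..\<tau>max} \<and> \<tau> = \<beta> ^ j * t0 \<and> accept \<tau> \<and>
        (\<forall>i<j. \<not> accept (\<beta> ^ i * t0)))"

text \<open>
  An infinite run: the stopping test never succeeds, that is, \<open>w k \<noteq> 0\<close> for all \<open>k\<close>.
  The sequence \<open>Ref\<close> consists of the reference values.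
\<close>

definition nonmonotone_subgradient_run ::
  "'a::euclidean_space set \<Rightarrow> ('a \<Rightarrow> 'a \<Rightarrow> 'a) \<Rightarrow> ('a \<Rightarrow> real) \<Rightarrow>
   real \<Rightarrow> real \<Rightarrow> real \<Rightarrow> real \<Rightarrow> real \<Rightarrow> real \<Rightarrow> real \<Rightarrow>
   (nat \<Rightarrow> 'a) \<Rightarrow> (nat \<Rightarrow> 'a) \<Rightarrow> (nat \<Rightarrow> 'a) \<Rightarrow>
   (nat \<Rightarrow> real) \<Rightarrow> (nat \<Rightarrow> real) \<Rightarrow> (nat \<Rightarrow> real) \<Rightarrow> bool" where
  "nonmonotone_subgradient_run M R \<phi> \<tau>min \<tau>max \<sigma> \<beta> pmin a b x w d \<tau> p Ref \<longleftrightarrow>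
     x 0 \<in> M \<and> Ref 0 = \<phi> (x 0) \<and>
     (\<forall>k. w k \<in> proj_subdifferential M \<phi> (x k) \<and> w k \<noteq> 0 \<and>
          d k \<in> tangent_space M (x k) - {0} \<and>
          w k \<bullet> d k \<le> - a * (norm (d k))\<^sup>2 \<and> norm (w k) \<le> b * norm (d k) \<and>
          backtracking_step
            (\<lambda>t. \<phi> (R (x k) (t *\<^sub>R d k)) \<le> Ref k + \<sigma> * t * (w k \<bullet> d k))
            \<beta> \<tau>min \<tau>max (\<tau> k) \<and>
          x (Suc k) = R (x k) (\<tau> k *\<^sub>R d k) \<and>
          p (Suc k) \<in> {pmin..1} \<and>
          Ref (Suc k) = (1 - p (Suc k)) * Ref k + p (Suc k) * \<phi> (x (Suc k)))"

definition R_linear :: "(nat \<Rightarrow> 'a::real_normed_vector) \<Rightarrow> 'a \<Rightarrow> bool" where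
  "R_linear z l \<longleftrightarrow> limsup (\<lambda>k. ereal (norm (z k - l) powr (1 / real k))) < 1"

end

theory Submission
  imports Defs
begin

text \<open>
  The reference values decrease to \<open>\<phi> xs\<close>, and near \<open>xs\<close> the stepsizes are bounded below, so
  with \<open>D k = Ref k - \<phi> xs\<close> the gap \<open>D k - D (k + 1)\<close> dominates a multiple of the squared norm of
  \<open>d k\<close>, while the retraction moves \<open>x k\<close> by at most a multiple of the norm of \<open>d k\<close>.  If \<open>\<phi> (x k) - \<phi> xs\<close>
  is at most \<open>D k / 2\<close>, the averaging step has just reduced \<open>D\<close> by a fixed factor, and the norm of \<open>d k\<close>
  is bounded by the decrease of \<open>sqrt \<circ> D\<close>.  Otherwise the KL inequality at \<open>x k\<close> bounds it by
  the decrease of \<open>\<chi> (D k / 2)\<close> for the desingularization function \<open>\<chi>\<close>.  Hence the steps telescope once an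
  iterate is close enough to \<open>xs\<close>.  For \<open>\<chi> t = c * t powr \<theta>\<close> the same dichotomy is a recursion for \<open>D\<close> that gives the rates.

  To apply KL with \<open>w k\<close> one needs that projecting a limiting subgradient onto the tangent space
  gives a limiting subgradient again: the projection subtracts a normal vector, which is a limit of
  normal vectors at nearby points of the manifold.
\<close>

subsection \<open>Tangent spaces and projected subgradients\<close>

text \<open>The rank \<open>m\<close> is at most the cardinality of the set of gradients, which is
  at most \<open>m\<close>, so the \<open>m\<close> gradients are distinct and independent.
  Functionals dual to them extend to the whole space, and their Riesz vectors are the
  \<open>h j\<close>.\<close>

lemma local_defining_map_dual_basis:
  assumes "local_defining_map M m x U F G"
  obtains h where "\<And>i j. i < m \<Longrightarrow> j < m \<Longrightarrow> G i x \<bullet> h j = of_bool (i = j)"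
proof -
  let ?g = "\<lambda>i. G i x"
  have dim: "dim (?g ` {..<m}) = m"
    using assms by (simp add: local_defining_map_def)
  have "card (?g ` {..<m}) \<le> m"
    using card_image_le[of "{..<m}" ?g] by simp
  moreover have "dim (?g ` {..<m}) \<le> card (?g ` {..<m})"
    by (intro dim_le_card') simp
  ultimately have card: "card (?g ` {..<m}) = m"
    using dim by simp
  then have inj: "inj_on ?g {..<m}"
    by (intro eq_card_imp_inj_on) simp_all
  have indep: "independent (?g ` {..<m})"
    using card dim by (intro card_le_dim_spanning[of _ "span (?g ` {..<m})"]) (auto simp: span_superset)
  have "\<exists>h. \<forall>i<m. ?g i \<bullet> h = of_bool (i = j)" for j
  proof -
    obtain f :: "'a \<Rightarrow> real" where f: "linear f" "\<forall>y\<in>?g ` {..<m}. f y = of_bool (the_inv_into {..<m} ?g y = j)"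
      using linear_independent_extend[OF indep, of "\<lambda>y. of_bool (the_inv_into {..<m} ?g y = j)"] by blast
    have "f y = y \<bullet> (\<Sum>b\<in>Basis. f b *\<^sub>R b)" for y
    proof -
      have "f y = f (\<Sum>b\<in>Basis. (y \<bullet> b) *\<^sub>R b)"
        by (simp add: euclidean_representation)
      also have "\<dots> = (\<Sum>b\<in>Basis. (y \<bullet> b) * f b)"
        using f(1) by (simp add: linear_sum linear_cmul)
      finally show ?thesis
        by (simp add: inner_sum_right mult.commute)
    qed
    moreover have "f (?g i) = of_bool (i = j)" if "i < m" for i
      using f(2) that the_inv_into_f_f[OF inj] by auto
    ultimately show ?thesis
      by metis
  qed
  then show ?thesis
    using that by metis
qed

text \<open>
  With the dual basis \<open>h\<close> of the gradients at \<open>x\<close>, the map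
  \<open>y \<mapsto> y - x + (\<Sum>i<m. (F i y - G i x \<bullet> (y - x)) *\<^sub>R h i)\<close> has the identity as derivative at \<open>x\<close>,
  and its local inverse carries kernel directions to curves in \<open>M\<close>.
\<close>

lemma local_defining_map_curve:
  assumes "local_defining_map M m x U F G" and "x \<in> M" and v: "\<forall>i<m. v \<bullet> G i x = 0"
  obtains \<gamma> where "(\<gamma> has_vector_derivative v) (at 0)" "\<gamma> 0 = x" "\<forall>\<^sub>F t in nhds (0::real). \<gamma> t \<in> M"
proof -
  have U: "open U" "x \<in> U" and M: "M \<inter> U = {y \<in> U. \<forall>i<m. F i y = 0}"
    and dF: "\<And>i y. i < m \<Longrightarrow> y \<in> U \<Longrightarrow> (F i has_derivative (\<lambda>k. G i y \<bullet> k)) (at y)"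
    and cG: "\<And>i. i < m \<Longrightarrow> continuous_on U (G i)"
    using assms(1) by (auto simp: local_defining_map_def gderiv_def inner_commute)
  obtain h where h: "\<And>i j. i < m \<Longrightarrow> j < m \<Longrightarrow> G i x \<bullet> h j = of_bool (i = j)"
    using local_defining_map_dual_basis[OF assms(1)] by blast
  define f where "f y = y - x + (\<Sum>i<m. (F i y - G i x \<bullet> (y - x)) *\<^sub>R h i)" for y
  define f' where "f' y = Blinfun (\<lambda>k. k + (\<Sum>i<m. (G i y \<bullet> k - G i x \<bullet> k) *\<^sub>R h i))" for y
  have f'_apply: "blinfun_apply (f' y) = (\<lambda>k. k + (\<Sum>i<m. (G i y \<bullet> k - G i x \<bullet> k) *\<^sub>R h i))" for y
    unfolding f'_def
    by (intro bounded_linear_Blinfun_apply bounded_linear_add bounded_linear_ident bounded_linear_sum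
        bounded_linear_scaleR_const bounded_linear_sub bounded_linear_inner_right)
  have fx: "f x = 0"
  proof -
    have "\<forall>i<m. F i x = 0"
      using M U(2) \<open>x \<in> M\<close> by blast
    then show ?thesis
      by (simp add: f_def)
  qed
  have f'x: "f' x = id_blinfun"
    by (intro blinfun_eqI) (simp add: f'_apply)
  have df: "(f has_derivative blinfun_apply (f' y)) (at y)" if "y \<in> U" for y
    unfolding f'_apply f_def using dF[OF _ that]
    by (auto intro!: derivative_eq_intros)
  have cf': "continuous_on U f'"
    by (intro continuous_on_blinfun_componentwise) (auto simp: f'_apply intro!: continuous_intros cG)
  have inv: "id_blinfun o\<^sub>L f' x = id_blinfun"
    by (intro blinfun_eqI) (simp add: f'x)
  obtain U' V g g' where U': "open U'" "U' \<subseteq> U" "x \<in> U'" and V: "open V" "f x \<in> V"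
    and hom: "homeomorphism U' V f g"
    and dg: "\<And>y. y \<in> V \<Longrightarrow> (g has_derivative (g' y)) (at y)"
    and g': "\<And>y. y \<in> V \<Longrightarrow> g' y = inv (blinfun_apply (f'(g y)))"
    by (rule inverse_function_theorem[OF U(1) df cf' U(2) inv]) (assumption, rule that)
  have g0: "g 0 = x"
    using hom U'(3) fx by (metis homeomorphism_apply1)
  have g'0: "g' 0 = (\<lambda>k. k)"
    using g' V fx g0 f'x by (auto simp: inv_id[unfolded id_def])
  let ?\<gamma> = "\<lambda>t. g (t *\<^sub>R v)"
  have "((\<lambda>t. t *\<^sub>R v) has_derivative (\<lambda>t. t *\<^sub>R v)) (at 0)"
    by (auto intro!: derivative_eq_intros)
  moreover have "(g has_derivative (\<lambda>k. k)) (at (0 *\<^sub>R v))"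
    using dg[of 0] V(2) fx g'0 by simp
  ultimately have "(?\<gamma> has_derivative (\<lambda>t. t *\<^sub>R v)) (at 0)"
    by (rule has_derivative_compose[of "\<lambda>t. t *\<^sub>R v"])
  then have 1: "(?\<gamma> has_vector_derivative v) (at 0)"
    by (simp add: has_vector_derivative_def)
  have "((\<lambda>t. t *\<^sub>R v) \<longlongrightarrow> 0) (nhds 0)"
    by (auto intro!: tendsto_eq_intros filterlim_ident)
  then have "\<forall>\<^sub>F t in nhds 0. t *\<^sub>R v \<in> V"
    using V fx by (auto dest: topological_tendstoD)
  then have "\<forall>\<^sub>F t in nhds 0. ?\<gamma> t \<in> M"
  proof eventually_elim
    case (elim t)
    then have gU: "g (t *\<^sub>R v) \<in> U'" and fg: "f (g (t *\<^sub>R v)) = t *\<^sub>R v"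
      using hom by (auto simp: homeomorphism_def)
    have "F j (g (t *\<^sub>R v)) = 0" if "j < m" for j
    proof -
      \<comment> \<open>By duality, pairing with \<open>G j x\<close> picks out one coefficient of
        the sum and the linear terms cancel, so \<open>f\<close> encodes the defining
        functions.\<close>
      have "G j x \<bullet> f y = F j y" for y
      proof -
        have "G j x \<bullet> f y = G j x \<bullet> (y - x) + (\<Sum>i<m. (F i y - G i x \<bullet> (y - x)) * of_bool (j = i))"
          using that by (simp add: f_def inner_add_right inner_sum_right h)
        also have "\<dots> = F j y"
          using that by (simp add: of_bool_def if_distrib sum.delta cong: if_cong)
        finally show ?thesis .
      qed
      then have "F j (g (t *\<^sub>R v)) = G j x \<bullet> (t *\<^sub>R v)"
        using fg by metis
      then show ?thesis
        using v that by (simp add: inner_commute)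
    qed
    then show ?case
      using gU U'(2) M by blast
  qed
  then show ?thesis
    using that[OF 1] g0 by simp
qed

text \<open>A kernel vector of one defining map is the velocity of a curve in \<open>M\<close>.
  Every component of the other map vanishes along that curve, so its derivative in this direction is
  zero.\<close>

lemma local_defining_map_kernel_subset:
  assumes "local_defining_map M m x U F G" and "local_defining_map M n x U' F' G'" and "x \<in> M"
    and "\<forall>i<m. v \<bullet> G i x = 0" and "i < n"
  shows "v \<bullet> G' i x = 0"
proof -
  obtain \<gamma> where \<gamma>: "(\<gamma> has_vector_derivative v) (at 0)" "\<gamma> 0 = x" "\<forall>\<^sub>F t in nhds (0::real). \<gamma> t \<in> M"
    using local_defining_map_curve[OF assms(1,3,4)] by blast
  have U': "open U'" "x \<in> U'" and M: "M \<inter> U' = {y \<in> U'. \<forall>i<n. F' i y = 0}"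
    and dF: "(F' i has_derivative (\<lambda>k. G' i x \<bullet> k)) (at x)"
    using assms(2,5) by (auto simp: local_defining_map_def gderiv_def inner_commute)
  have "(\<gamma> \<longlongrightarrow> x) (nhds 0)"
    using has_vector_derivative_continuous[OF \<gamma>(1)] \<gamma>(2) by (metis isCont_def tendsto_at_iff_tendsto_nhds)
  then have "\<forall>\<^sub>F t in nhds 0. \<gamma> t \<in> U'"
    using U' by (auto dest: topological_tendstoD)
  with \<gamma>(3) have "\<forall>\<^sub>F t in nhds 0. F' i (\<gamma> t) = 0"
    by eventually_elim (use M assms(5) in blast)
  moreover have "((\<lambda>t. F' i (\<gamma> t)) has_derivative (\<lambda>t. G' i x \<bullet> (t *\<^sub>R v))) (at 0)"
    by (rule has_derivative_compose[of \<gamma>, OF \<gamma>(1)[unfolded has_vector_derivative_def]]) (use \<gamma>(2) dF in simp)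
  then have "((\<lambda>t. F' i (\<gamma> t)) has_real_derivative G' i x \<bullet> v) (at 0)"
    by (simp add: has_field_derivative_def mult.commute[of _ "G' i x \<bullet> v"])
  ultimately have "((\<lambda>t::real. 0) has_real_derivative G' i x \<bullet> v) (at 0)"
    using DERIV_cong_ev[of 0 0 "\<lambda>t. F' i (\<gamma> t)" "\<lambda>t. 0"] by blast
  then have "G' i x \<bullet> v = 0"
    using DERIV_unique DERIV_const by blast
  then show ?thesis
    by (simp add: inner_commute)
qed

text \<open>Lets any single local defining map replace the existential quantifier in
  \<open>tangent_space\<close>, which exhibits the tangent space as a linear subspace.\<close>

lemma tangent_space_eq_kernel:
  assumes "local_defining_map M m x U F G" and "x \<in> M"
  shows "tangent_space M x = {v. \<forall>i<m. v \<bullet> G i x = 0}"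
  using assms local_defining_map_kernel_subset[OF _ assms(1) assms(2)]
  unfolding tangent_space_def by blast

lemma tangent_space_scaleR: "v \<in> tangent_space M x \<Longrightarrow> c *\<^sub>R v \<in> tangent_space M x"
  unfolding tangent_space_def by fastforce

lemma zero_mem_tangent_space: "embedded_submanifold M \<Longrightarrow> x \<in> M \<Longrightarrow> 0 \<in> tangent_space M x"
  unfolding tangent_space_def embedded_submanifold_def by fastforce

text \<open>The residual is orthogonal to the common kernel of the gradients, hence lies in their
  span. Explicit coefficients can be kept fixed when the base point is moved later.\<close>

lemma minus_closest_point_tangent_space:
  assumes "local_defining_map M m x U F G" and "x \<in> M"
  obtains c where "v - closest_point (tangent_space M x) v = (\<Sum>i<m. c i *\<^sub>R G i x)"
proof -
  note T = tangent_space_eq_kernel[OF assms]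
  let ?T = "tangent_space M x"
  let ?n = "v - closest_point ?T v"
  obtain h where h: "\<And>i j. i < m \<Longrightarrow> j < m \<Longrightarrow> G i x \<bullet> h j = of_bool (i = j)"
    using local_defining_map_dual_basis[OF assms(1)] by blast
  have eq: "?T = (\<Inter>i\<in>{..<m}. {v. G i x \<bullet> v = 0})"
    unfolding T by (auto simp: inner_commute)
  have T': "closed ?T" "convex ?T"
    unfolding eq by (auto intro!: closed_INT convex_INT closed_hyperplane convex_hyperplane)
  have cp: "closest_point ?T v \<in> ?T"
  proof (rule closest_point_in_set[OF T'(1)])
    have "0 \<in> ?T"
      unfolding T by simp
    then show "?T \<noteq> {}"
      by blast
  qed
  \<comment> \<open>The variational inequality for the closest point, used at
    \<open>closest_point ?T v + u\<close> and at \<open>closest_point ?T v - u\<close>, gives both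
    signs.\<close>
  have orth: "?n \<bullet> u = 0" if "u \<in> ?T" for u
  proof -
    have "closest_point ?T v + u \<in> ?T" "closest_point ?T v - u \<in> ?T"
      using cp that unfolding T by (auto simp: inner_add_left inner_diff_left)
    then show ?thesis
      using closest_point_dot[OF T'(2,1), of _ v] by (smt (verit) add_diff_cancel_left' diff_diff_eq2 inner_diff_right)
  qed
  have "?n \<bullet> u = (\<Sum>i<m. (?n \<bullet> h i) *\<^sub>R G i x) \<bullet> u" for u
  proof -
    \<comment> \<open>Removing the dual-basis part of \<open>u\<close> leaves a tangent vector;
      testing the residual against it yields the coefficients
      \<open>?n \<bullet> h i\<close>.\<close>
    have "(u - (\<Sum>i<m. (G i x \<bullet> u) *\<^sub>R h i)) \<bullet> G j x = 0" if "j < m" for j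
    proof -
      have "(\<Sum>i<m. (G i x \<bullet> u) *\<^sub>R h i) \<bullet> G j x = (\<Sum>i<m. (G i x \<bullet> u) * of_bool (j = i))"
        using that by (simp add: inner_sum_left inner_commute[of "h _"] h)
      also have "\<dots> = G j x \<bullet> u"
        using that by (simp add: of_bool_def if_distrib sum.delta cong: if_cong)
      finally show ?thesis
        by (simp add: inner_diff_left inner_commute[of u])
    qed
    then have "?n \<bullet> (u - (\<Sum>i<m. (G i x \<bullet> u) *\<^sub>R h i)) = 0"
      using orth T by blast
    then show ?thesis
      by (simp add: inner_diff_right inner_sum_right inner_sum_left mult.commute)
  qed
  then have "?n = (\<Sum>i<m. (?n \<bullet> h i) *\<^sub>R G i x)"
    by (metis vector_eq_rdot)
  then show ?thesis
    by (rule that)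
qed

section \<open>Normal perturbations of regular and limiting subgradients\<close>

lemma extend_by_infty_eq: "extend_by_infty M \<phi> x = (if x \<in> M then ereal (\<phi> x) else \<infinity>)"
  by (simp add: extend_by_infty_def delta_ind_def)

text \<open>Outside \<open>M\<close> the difference quotient is \<infinity>, so only points of
  \<open>M\<close> can lower the limit inferior. The resulting criterion is free of extended
  reals.\<close>

lemma regular_subdifferential_extend_by_infty:
  "v \<in> regular_subdifferential (extend_by_infty M \<phi>) x \<longleftrightarrow>
     x \<in> M \<and> (\<forall>e>0. \<forall>\<^sub>F y in at x within M. - e * norm (y - x) \<le> \<phi> y - \<phi> x - v \<bullet> (y - x))"
proof (cases "x \<in> M")
  case True
  let ?g = "extend_by_infty M \<phi>"
  let ?q = "\<lambda>y. (?g y - ?g x - ereal (v \<bullet> (y - x))) / ereal (norm (y - x))"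
  have q: "ereal (- e) \<le> ?q y \<longleftrightarrow> (y \<in> M \<longrightarrow> - e * norm (y - x) \<le> \<phi> y - \<phi> x - v \<bullet> (y - x))"
    if "y \<noteq> x" for e y
    using True that by (auto simp: extend_by_infty_eq field_simps)
  have ev: "(\<forall>\<^sub>F y in at x. ereal (- e) \<le> ?q y) \<longleftrightarrow>
      (\<forall>\<^sub>F y in at x within M. - e * norm (y - x) \<le> \<phi> y - \<phi> x - v \<bullet> (y - x))" for e
    unfolding eventually_at_filter
    by (intro arg_cong[of _ _ "\<lambda>P. eventually P (nhds x)"] ext) (metis q UNIV_I)
  have "0 \<le> Liminf (at x) ?q \<longleftrightarrow> (\<forall>e>0. \<forall>\<^sub>F y in at x. ereal (- e) \<le> ?q y)"
  proof
    assume L: "0 \<le> Liminf (at x) ?q"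
    show "\<forall>e>0. \<forall>\<^sub>F y in at x. ereal (- e) \<le> ?q y"
    proof (intro allI impI)
      fix e :: real assume "e > 0"
      then have "\<forall>\<^sub>F y in at x. ereal (- e) < ?q y"
        using L unfolding le_Liminf_iff by (auto simp: zero_ereal_def)
      then show "\<forall>\<^sub>F y in at x. ereal (- e) \<le> ?q y"
        by eventually_elim simp
    qed
  next
    assume R: "\<forall>e>0. \<forall>\<^sub>F y in at x. ereal (- e) \<le> ?q y"
    show "0 \<le> Liminf (at x) ?q"
      unfolding le_Liminf_iff
    proof (intro allI impI)
      fix z :: ereal assume "z < 0"
      then obtain s where s: "z < ereal s" "ereal s < 0"
        using ereal_dense2 by blast
      then have "\<forall>\<^sub>F y in at x. ereal s \<le> ?q y"
        using R[rule_format, of "- s"] by (simp add: zero_ereal_def)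
      then show "\<forall>\<^sub>F y in at x. z < ?q y"
        by eventually_elim (use s in order)
    qed
  qed
  then show ?thesis
    unfolding ev
    using True by (simp add: regular_subdifferential_def extend_by_infty_eq)
qed (simp add: regular_subdifferential_def extend_by_infty_eq)

text \<open>On \<open>M\<close> the combination of the \<open>F i\<close> with coefficients
  \<open>c i\<close> is zero, so its first-order expansion at \<open>z\<close> shows that the added
  normal vector contributes only o(\<open>norm (y - z)\<close>) along \<open>M\<close>.\<close>

lemma regular_subdifferential_add_normal:
  assumes "local_defining_map M m x U F G" and "z \<in> U"
    and v: "v \<in> regular_subdifferential (extend_by_infty M \<phi>) z"
  shows "v + (\<Sum>i<m. c i *\<^sub>R G i z) \<in> regular_subdifferential (extend_by_infty M \<phi>) z"
  unfolding regular_subdifferential_extend_by_infty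
proof (intro conjI allI impI)
  have U: "open U" and M: "M \<inter> U = {y \<in> U. \<forall>i<m. F i y = 0}"
    and dF: "\<And>i. i < m \<Longrightarrow> (F i has_derivative (\<lambda>k. G i z \<bullet> k)) (at z)"
    using assms(1,2) by (auto simp: local_defining_map_def gderiv_def inner_commute)
  let ?n = "\<Sum>i<m. c i *\<^sub>R G i z"
  have z: "z \<in> M" and v': "\<And>e. e > 0 \<Longrightarrow> \<forall>\<^sub>F y in at z within M. - e * norm (y - z) \<le> \<phi> y - \<phi> z - v \<bullet> (y - z)"
    using v by (auto simp: regular_subdifferential_extend_by_infty)
  show "z \<in> M" by (fact z)
  fix e :: real assume "e > 0"
  have "((\<lambda>y. \<Sum>i<m. c i * F i y) has_derivative (\<lambda>k. ?n \<bullet> k)) (at z)"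
    unfolding inner_sum_left inner_scaleR_left
    by (intro has_derivative_sum has_derivative_mult_right dF) simp
  then have "\<forall>e>0. \<exists>\<delta>>0. \<forall>y. norm (y - z) < \<delta> \<longrightarrow>
      norm ((\<Sum>i<m. c i * F i y) - (\<Sum>i<m. c i * F i z) - ?n \<bullet> (y - z)) \<le> e * norm (y - z)"
    unfolding has_derivative_at_alt by (rule conjunct2)
  \<comment> \<open>One half of \<open>e\<close> pays for the derivative remainder, the other half
    for the inequality of \<open>v\<close>.\<close>
  from this[rule_format, of "e/2"] obtain \<delta> where \<delta>: "\<delta> > 0" "\<And>y. norm (y - z) < \<delta> \<Longrightarrow>
      norm ((\<Sum>i<m. c i * F i y) - (\<Sum>i<m. c i * F i z) - ?n \<bullet> (y - z)) \<le> e/2 * norm (y - z)"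
    using \<open>e > 0\<close> by auto
  have "\<forall>\<^sub>F y in at z within M. y \<in> U"
    using eventually_nhds_in_open[OF U assms(2)] by (simp add: eventually_at_filter eventually_mono)
  moreover have "\<forall>\<^sub>F y in at z within M. norm (y - z) < \<delta>"
    using \<delta>(1) by (auto simp: eventually_at dist_norm)
  moreover have "\<forall>\<^sub>F y in at z within M. y \<in> M"
    by (simp add: eventually_at_filter)
  moreover have "\<forall>\<^sub>F y in at z within M. - (e/2) * norm (y - z) \<le> \<phi> y - \<phi> z - v \<bullet> (y - z)"
    using v'[of "e/2"] \<open>e > 0\<close> by simp
  ultimately show "\<forall>\<^sub>F y in at z within M. - e * norm (y - z) \<le> \<phi> y - \<phi> z - (v + ?n) \<bullet> (y - z)"
  proof eventually_elim
    case (elim y)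
    have "F i y = 0" "F i z = 0" if "i < m" for i
      using that elim M z assms(2) by blast+
    then have "norm (?n \<bullet> (y - z)) \<le> e/2 * norm (y - z)"
      using \<delta>(2)[of y] elim by simp
    then have "?n \<bullet> (y - z) \<le> e/2 * norm (y - z)"
      by simp
    moreover have "- (e/2) * norm (y - z) - e/2 * norm (y - z) = - e * norm (y - z)"
      by (simp add: field_simps)
    ultimately show ?case
      using elim(4) unfolding inner_add_left by linarith
  qed
qed

text \<open>Makes \<open>w k\<close> an admissible competitor in the distance that occurs in the KL
  inequality.\<close>

lemma proj_subdifferential_subset_limiting:
  assumes "embedded_submanifold M" and "x \<in> M"
  shows "proj_subdifferential M \<phi> x \<subseteq> limiting_subdifferential (extend_by_infty M \<phi>) x"
proof
  fix w assume "w \<in> proj_subdifferential M \<phi> x"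
  then obtain v where v: "v \<in> limiting_subdifferential (extend_by_infty M \<phi>) x"
      and w: "w = closest_point (tangent_space M x) v"
    by (auto simp: proj_subdifferential_def)
  obtain m U F G where ldm: "local_defining_map M m x U F G"
    using assms by (auto simp: embedded_submanifold_def)
  have U: "open U" "x \<in> U" and cG: "\<And>i. i < m \<Longrightarrow> continuous_on U (G i)"
    using ldm by (auto simp: local_defining_map_def)
  obtain c where c: "v - w = (\<Sum>i<m. c i *\<^sub>R G i x)"
    using minus_closest_point_tangent_space[OF ldm assms(2)] w by metis
  obtain X V where X: "X \<longlonglongrightarrow> x" "(\<lambda>k. extend_by_infty M \<phi> (X k)) \<longlonglongrightarrow> extend_by_infty M \<phi> x"
    and V: "\<And>k. V k \<in> regular_subdifferential (extend_by_infty M \<phi>) (X k)" "V \<longlonglongrightarrow> v"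
    using v by (auto simp: limiting_subdifferential_def)
  obtain N where N: "\<And>k. X (k + N) \<in> U"
    using topological_tendstoD[OF X(1) U] by (auto simp: eventually_sequentially) (metis le_add2)
  \<comment> \<open>The coefficients \<open>c\<close> found at \<open>x\<close> are kept and only
    the gradients move with \<open>X (k + N)\<close>: every term is then a regular subgradient, and
    continuity of the \<open>G i\<close> gives the limit \<open>w\<close>.\<close>
  let ?W = "\<lambda>k. V (k + N) + (\<Sum>i<m. (- c i) *\<^sub>R G i (X (k + N)))"
  have X': "(\<lambda>k. X (k + N)) \<longlonglongrightarrow> x"
    using X(1) by (rule LIMSEQ_ignore_initial_segment)
  have "(\<lambda>k. G i (X (k + N))) \<longlonglongrightarrow> G i x" if "i < m" for i
    using continuous_on_tendsto_compose[OF cG[OF that] X' U(2)] N by simp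
  then have "?W \<longlonglongrightarrow> v + (\<Sum>i<m. (- c i) *\<^sub>R G i x)"
    using LIMSEQ_ignore_initial_segment[OF V(2), of N] by (intro tendsto_intros) auto
  also have "v + (\<Sum>i<m. (- c i) *\<^sub>R G i x) = w"
    using c by (simp add: sum_negf algebra_simps)
  finally have "?W \<longlonglongrightarrow> w" .
  moreover have "?W k \<in> regular_subdifferential (extend_by_infty M \<phi>) (X (k + N))" for k
    by (rule regular_subdifferential_add_normal[OF ldm N V(1)])
  moreover have "(\<lambda>k. extend_by_infty M \<phi> (X (k + N))) \<longlonglongrightarrow> extend_by_infty M \<phi> x"
    using X(2) by (rule LIMSEQ_ignore_initial_segment)
  ultimately show "w \<in> limiting_subdifferential (extend_by_infty M \<phi>) x"
    using X' assms(2) unfolding limiting_subdifferential_def extend_by_infty_eq[of M \<phi> x] mem_Collect_eq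
    by (intro conjI exI[of _ "\<lambda>k. X (k + N)"] exI[of _ ?W]) auto
qed

section \<open>Local Lipschitz bounds and the retraction\<close>

text \<open>Near \<open>z\<close> the derivative stays within distance 1 of \<open>f' z\<close>, so
  the mean value inequality on the convex ball applies with constant
  \<open>norm (f' z) + 1\<close>.\<close>

lemma C1_on_lipschitz_near:
  assumes "C1_on W f" and "open W" and "z \<in> W"
  obtains L e where "L \<ge> 0" "e > 0" "ball z e \<subseteq> W"
    "\<And>y y'. y \<in> ball z e \<Longrightarrow> y' \<in> ball z e \<Longrightarrow> norm (f y - f y') \<le> L * norm (y - y')"
proof -
  obtain f' where f': "\<And>y. y \<in> W \<Longrightarrow> (f has_derivative blinfun_apply (f' y)) (at y)"
    and cont: "continuous_on W f'"
    using assms(1) by (auto simp: C1_on_def)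
  have "isCont f' z"
    using cont assms(2,3) by (simp add: continuous_on_eq_continuous_at)
  then have "\<forall>\<^sub>F y in nhds z. dist (f' y) (f' z) < 1"
    by (metis isCont_def tendstoD tendsto_at_iff_tendsto_nhds zero_less_one)
  moreover have "\<forall>\<^sub>F y in nhds z. y \<in> W"
    using assms(2,3) by (rule eventually_nhds_in_open)
  ultimately have "\<forall>\<^sub>F y in nhds z. y \<in> W \<and> dist (f' y) (f' z) < 1"
    by eventually_elim simp
  then obtain e where e: "e > 0" "\<And>y. dist y z < e \<Longrightarrow> y \<in> W \<and> dist (f' y) (f' z) < 1"
    by (auto simp: eventually_nhds_metric)
  show ?thesis
  proof
    show "0 \<le> norm (f' z) + 1" by simp
    show "e > 0" by fact
    show "ball z e \<subseteq> W" using e by (auto simp: dist_commute)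
    fix y y' assume "y \<in> ball z e" "y' \<in> ball z e"
    then show "norm (f y - f y') \<le> (norm (f' z) + 1) * norm (y - y')"
    proof (intro differentiable_bound[of "ball z e"])
      fix u assume "u \<in> ball z e"
      then have u: "u \<in> W" "dist (f' u) (f' z) < 1"
        using e(2)[of u] by (auto simp: dist_commute)
      show "(f has_derivative blinfun_apply (f' u)) (at u within ball z e)"
        using f'[OF u(1)] by (rule has_derivative_at_withinI)
      have "norm (f' u) \<le> norm (f' z) + norm (f' u - f' z)"
        by (metis add.commute diff_add_cancel norm_triangle_ineq)
      then show "onorm (blinfun_apply (f' u)) \<le> norm (f' z) + 1"
        using u(2) by (simp add: norm_blinfun.rep_eq[symmetric] dist_norm)
    qed auto
  qed
qed

text \<open>As \<open>y\<close> equals \<open>R y 0\<close>, the displacement is the difference of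
  one smooth local extension at \<open>(y, \<xi>)\<close> and \<open>(y, 0)\<close>. Its Lipschitz
  constant near \<open>(xs, 0)\<close> serves all nearby base points at once.\<close>

lemma retraction_norm_bound:
  assumes "embedded_submanifold M" and R: "manifold_retraction M R" and "xs \<in> M"
  obtains L e where "L > 0" "e > 0"
    "\<And>y \<xi>. y \<in> M \<Longrightarrow> \<xi> \<in> tangent_space M y \<Longrightarrow> norm (y - xs) < e \<Longrightarrow> norm \<xi> < e \<Longrightarrow>
       norm (R y \<xi> - y) \<le> L * norm \<xi>"
proof -
  have "(xs, 0) \<in> tangent_bundle M"
    using zero_mem_tangent_space[OF assms(1,3)] assms(3) by (simp add: tangent_bundle_def)
  then obtain W f where W: "open W" "(xs, 0) \<in> W" "C2_on W f"
      and f: "\<And>y \<zeta>. (y, \<zeta>) \<in> W \<Longrightarrow> (y, \<zeta>) \<in> tangent_bundle M \<Longrightarrow> R y \<zeta> = f (y, \<zeta>)"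
    using R unfolding manifold_retraction_def by fast
  have R0: "\<And>y. y \<in> M \<Longrightarrow> R y 0 = y"
    using R by (simp add: manifold_retraction_def)
  have "C1_on W f"
  proof -
    obtain f' where f': "\<And>y. y \<in> W \<Longrightarrow> (f has_derivative blinfun_apply (f' y)) (at y)" "C1_on W f'"
      using W(3) by (auto simp: C2_on_def)
    then have "continuous_on W f'"
      unfolding C1_on_def by (metis has_derivative_continuous continuous_at_imp_continuous_on)
    with f'(1) show ?thesis
      unfolding C1_on_def by blast
  qed
  then obtain L e where Le: "L \<ge> 0" "e > 0" "ball (xs, 0) e \<subseteq> W"
    "\<And>y y'. y \<in> ball (xs, 0) e \<Longrightarrow> y' \<in> ball (xs, 0) e \<Longrightarrow> norm (f y - f y') \<le> L * norm (y - y')"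
    using C1_on_lipschitz_near W(1,2) by metis
  show ?thesis
  proof
    \<comment> \<open>Adding 1 makes the constant positive; halving \<open>e\<close> keeps the pair
      \<open>(y, \<xi>)\<close> in the ball of the product space.\<close>
    show "L + 1 > 0" "e / 2 > 0"
      using Le by simp_all
    fix y \<xi> assume y: "y \<in> M" and \<xi>: "\<xi> \<in> tangent_space M y" and n: "norm (y - xs) < e/2" "norm \<xi> < e/2"
    have ball: "(y, \<xi>) \<in> ball (xs, 0) e" "(y, 0) \<in> ball (xs, 0) e"
    proof -
      have "dist (xs, 0) (y, \<xi>) \<le> norm (y - xs) + norm \<xi>"
        using norm_Pair_le[of "xs - y" "- \<xi>"] by (simp add: dist_norm norm_minus_commute)
      then show "(y, \<xi>) \<in> ball (xs, 0) e"
        using n by simp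
      show "(y, 0) \<in> ball (xs, 0) e"
        using n(1) Le(2) by (simp add: dist_Pair_Pair dist_norm norm_minus_commute[of xs])
    qed
    have "R y \<xi> = f (y, \<xi>)" "R y 0 = f (y, 0)"
      using f ball Le(3) y \<xi> zero_mem_tangent_space[OF assms(1) y] by (auto simp: tangent_bundle_def)
    then have "norm (R y \<xi> - y) \<le> L * norm \<xi>"
      using Le(4)[OF ball] R0[OF y] by simp
    also have "\<dots> \<le> (L + 1) * norm \<xi>"
      by (simp add: mult_right_mono)
    finally show "norm (R y \<xi> - y) \<le> (L + 1) * norm \<xi>" .
  qed
qed

subsection \<open>Recursions for real sequences\<close>

lemma concave_on_tangent:
  fixes \<psi> :: "real \<Rightarrow> real"
  assumes "concave_on {0..\<eta>} \<psi>" and "(\<psi> has_real_derivative l) (at t)" and "t \<in> {0<..<\<eta>}" and "s \<in> {0..\<eta>}"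
  shows "\<psi> s - \<psi> t \<le> l * (s - t)"
proof -
  have "- l * (s - t) \<le> - \<psi> s - - \<psi> t"
  proof (rule convex_on_imp_above_tangent)
    show "convex_on {0..\<eta>} (\<lambda>t. - \<psi> t)"
      using assms(1) by (simp add: concave_on_def)
    show "((\<lambda>t. - \<psi> t) has_real_derivative - l) (at t within {0..\<eta>})"
      using assms(2) by (auto intro!: derivative_eq_intros intro: has_field_derivative_at_within)
  qed (use assms in auto)
  then show ?thesis
    by simp
qed

text \<open>Adding the tangent inequalities at \<open>s\<close> and at \<open>t\<close> cancels the
  function values.\<close>

lemma concave_on_deriv_antimono:
  fixes \<psi> :: "real \<Rightarrow> real"
  assumes "concave_on {0..\<eta>} \<psi>" and "\<And>t. t \<in> {0<..<\<eta>} \<Longrightarrow> (\<psi> has_real_derivative \<psi>' t) (at t)"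
    and "0 < s" and "s \<le> t" and "t < \<eta>"
  shows "\<psi>' t \<le> \<psi>' s"
proof (cases "s = t")
  case False
  have "\<psi> s - \<psi> t \<le> \<psi>' t * (s - t)" "\<psi> t - \<psi> s \<le> \<psi>' s * (t - s)"
    using assms by (auto intro!: concave_on_tangent[OF assms(1)])
  then have "0 \<le> (\<psi>' s - \<psi>' t) * (t - s)"
    by (simp add: algebra_simps)
  then show ?thesis
    using False assms(4) by (simp add: zero_le_mult_iff)
qed simp

text \<open>\<open>P\<close> is a potential that pays for the steps: while the iterates are near
  \<open>xs\<close>, \<open>norm (x k - xs) + P k\<close> does not increase. Once this sum is below
  \<open>e\<close> late enough in the sequence, the iterates never leave the ball and their steps
  telescope.\<close>

lemma LIMSEQ_trap:
  fixes x :: "nat \<Rightarrow> 'a::real_normed_vector"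
  assumes "e > 0" and step: "\<forall>\<^sub>F k in sequentially. norm (x k - xs) < e \<longrightarrow> norm (x (Suc k) - x k) \<le> P k - P (Suc k)"
    and P: "P \<longlonglongrightarrow> 0" and P_nonneg: "\<forall>\<^sub>F k in sequentially. 0 \<le> P k"
    and K: "strict_mono K" "(\<lambda>i. x (K i)) \<longlonglongrightarrow> xs"
  shows "x \<longlonglongrightarrow> xs" and "\<forall>\<^sub>F k in sequentially. norm (x k - xs) \<le> P k"
proof -
  obtain N where N: "\<And>k. k \<ge> N \<Longrightarrow> norm (x k - xs) < e \<Longrightarrow> norm (x (Suc k) - x k) \<le> P k - P (Suc k)"
      "\<And>k. k \<ge> N \<Longrightarrow> 0 \<le> P k"
    using eventually_conj[OF step P_nonneg] unfolding eventually_sequentially by blast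
  have K_top: "filterlim K at_top sequentially"
    using K(1) by (rule filterlim_subseq)
  have "\<forall>\<^sub>F i in sequentially. norm (x (K i) - xs) < e/2"
    using K(2) \<open>e > 0\<close> by (auto simp: dist_norm dest!: tendstoD[of _ _ _ "e/2"])
  moreover have "\<forall>\<^sub>F i in sequentially. P (K i) < e/2"
    by (rule order_tendstoD(2)[OF filterlim_compose[OF P K_top]]) (use \<open>e > 0\<close> in simp)
  moreover have "\<forall>\<^sub>F i in sequentially. N \<le> K i"
    using K_top by (simp add: filterlim_at_top)
  ultimately have "\<forall>\<^sub>F i in sequentially. norm (x (K i) - xs) < e/2 \<and> P (K i) < e/2 \<and> N \<le> K i"
    by eventually_elim simp
  then obtain i where i: "norm (x (K i) - xs) < e/2" "P (K i) < e/2" "N \<le> K i"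
    using eventually_happens'[OF sequentially_bot] by blast
  have near: "norm (x k - xs) + P k < e" if "k \<ge> K i" for k
    using that
  proof (induction k rule: dec_induct)
    case base
    then show ?case using i by simp
  next
    case (step k)
    then have "norm (x k - xs) < e" "N \<le> k"
      using N(2)[of k] i(3) by auto
    then have "norm (x (Suc k) - x k) \<le> P k - P (Suc k)"
      using N(1) by blast
    then show ?case
      using step.IH norm_triangle_ineq[of "x (Suc k) - x k" "x k - xs"] by simp
  qed
  have tail: "norm (x n - x k) \<le> P k - P n" if "k \<ge> K i" "n \<ge> k" for k n
    using that(2)
  proof (induction n rule: dec_induct)
    case (step n)
    then have "norm (x n - xs) < e" "N \<le> n"
      using near[of n] N(2)[of n] i(3) that(1) by auto
    then have "norm (x (Suc n) - x n) \<le> P n - P (Suc n)"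
      using N(1) by blast
    then show ?case
      using step.IH norm_triangle_ineq[of "x (Suc n) - x n" "x n - x k"] by simp
  qed simp
  \<comment> \<open>The far index runs along the subsequence, where convergence to \<open>xs\<close>
    is already known.\<close>
  have bound: "norm (x k - xs) \<le> P k" if "k \<ge> K i" for k
  proof -
    have "(\<lambda>j. norm (x (K j) - x k)) \<longlonglongrightarrow> norm (xs - x k)"
      using K(2) by (intro tendsto_intros)
    moreover have "\<forall>\<^sub>F j in sequentially. k \<le> K j"
      using K_top by (simp add: filterlim_at_top)
    then have "\<forall>\<^sub>F j in sequentially. norm (x (K j) - x k) \<le> P k"
    proof eventually_elim
      case (elim j)
      then show ?case
        using tail[OF that elim] N(2)[of "K j"] that i(3) by linarith
    qed
    ultimately have "norm (xs - x k) \<le> P k"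
      by (rule tendsto_upperbound) simp
    then show ?thesis
      by (simp add: norm_minus_commute)
  qed
  then show ev: "\<forall>\<^sub>F k in sequentially. norm (x k - xs) \<le> P k"
    unfolding eventually_sequentially by blast
  have "(\<lambda>k. x k - xs) \<longlonglongrightarrow> 0"
    using ev P by (rule Lim_null_comparison)
  then show "x \<longlonglongrightarrow> xs"
    by (simp add: LIM_zero_iff)
qed

section \<open>Linear and sublinear rates from two-step recursions\<close>

text \<open>\<open>A powr (1 / real k)\<close> tends to 1, so only \<open>\<rho>\<close> survives in
  the limit superior.\<close>

lemma R_linearI:
  fixes z :: "nat \<Rightarrow> 'a::real_normed_vector"
  assumes "\<forall>\<^sub>F k in sequentially. norm (z k - l) \<le> A * \<rho> ^ k" and "0 < A" and "0 < \<rho>" and "\<rho> < 1"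
  shows "R_linear z l"
proof -
  have "(\<lambda>k. A powr (1 / real k) * \<rho>) \<longlonglongrightarrow> A powr 0 * \<rho>"
    using assms(2) by (intro tendsto_intros lim_1_over_n) auto
  then have lim: "(\<lambda>k. ereal (A powr (1 / real k) * \<rho>)) \<longlonglongrightarrow> ereal \<rho>"
    using assms(2) by (simp add: powr_zero_eq_one)
  \<comment> \<open>Index 0 is left out: \<open>1 / real 0\<close> is 0, and the root of
    \<open>\<rho> ^ 0\<close> would not be \<open>\<rho>\<close>.\<close>
  have "\<forall>\<^sub>F k in sequentially. ereal (norm (z k - l) powr (1 / real k)) \<le> ereal (A powr (1 / real k) * \<rho>)"
    using assms(1) eventually_gt_at_top[of 0]
  proof eventually_elim
    case (elim k)
    have "norm (z k - l) powr (1 / real k) \<le> (A * \<rho> ^ k) powr (1 / real k)"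
      using elim by (intro powr_mono2) auto
    also have "\<dots> = A powr (1 / real k) * (\<rho> ^ k) powr (1 / real k)"
      using assms by (simp add: powr_mult)
    also have "(\<rho> ^ k) powr (1 / real k) = \<rho>"
      using assms elim by (simp add: powr_realpow[symmetric] powr_powr)
    finally show ?case
      by simp
  qed
  then have "limsup (\<lambda>k. ereal (norm (z k - l) powr (1 / real k))) \<le> limsup (\<lambda>k. ereal (A powr (1 / real k) * \<rho>))"
    by (rule Limsup_mono)
  also have "\<dots> = ereal \<rho>"
    using lim by (intro lim_imp_Limsup) auto
  also have "\<dots> < 1"
    using assms(4) by simp
  finally show ?thesis
    by (simp add: R_linear_def)
qed

text \<open>Both alternatives contract \<open>D\<close> by a fixed factor over two steps: once
  \<open>D\<close> is below 1, \<open>\<alpha> \<le> 1\<close> makes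
  \<open>D (Suc k) powr \<alpha>\<close> at least \<open>D (Suc k)\<close>, so the second one leaves
  at most the fraction \<open>1 - \<kappa>\<close>.\<close>

lemma two_step_linear_rate:
  fixes D :: "nat \<Rightarrow> real"
  assumes pos: "\<And>k. 0 < D k" and dec: "\<And>k. D (Suc k) \<le> D k" and "D \<longlonglongrightarrow> 0"
    and "0 < q" and "q < 1" and "0 < \<kappa>" and "\<alpha> \<le> 1"
    and alt: "\<forall>\<^sub>F k in sequentially. D (Suc k) \<le> q * D k \<or> \<kappa> * D (Suc k) powr \<alpha> \<le> D (Suc k) - D (Suc (Suc k))"
  obtains A \<rho> where "0 < A" "0 < \<rho>" "\<rho> < 1" "\<forall>\<^sub>F k in sequentially. D k \<le> A * \<rho> ^ k"
proof -
  have "\<forall>\<^sub>F k in sequentially. D k < 1"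
    using \<open>D \<longlonglongrightarrow> 0\<close> by (rule order_tendstoD) simp
  from eventually_conj[OF this alt] obtain N where N: "\<And>k. k \<ge> N \<Longrightarrow> D k < 1"
      "\<And>k. k \<ge> N \<Longrightarrow> D (Suc k) \<le> q * D k \<or> \<kappa> * D (Suc k) powr \<alpha> \<le> D (Suc k) - D (Suc (Suc k))"
    unfolding eventually_sequentially by blast
  define q' where "q' = max q (max (1 - \<kappa>) (1/2))"
  have q': "0 < q'" "q' < 1" "q \<le> q'" "1 - \<kappa> \<le> q'"
    using assms by (auto simp: q'_def)
  have two_step: "D (Suc (Suc k)) \<le> q' * D k" if "k \<ge> N" for k
    using N(2)[OF that]
  proof
    assume "D (Suc k) \<le> q * D k"
    then show ?thesis
      using dec[of "Suc k"] q'(3) pos[of k] by (meson mult_right_mono less_imp_le order_trans)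
  next
    assume *: "\<kappa> * D (Suc k) powr \<alpha> \<le> D (Suc k) - D (Suc (Suc k))"
    have "D (Suc k) powr 1 \<le> D (Suc k) powr \<alpha>"
      using N(1)[of "Suc k"] that pos[of "Suc k"] \<open>\<alpha> \<le> 1\<close> by (intro powr_mono') auto
    then have "\<kappa> * D (Suc k) \<le> \<kappa> * D (Suc k) powr \<alpha>"
      using pos[of "Suc k"] \<open>0 < \<kappa>\<close> by simp
    with * have "D (Suc (Suc k)) \<le> (1 - \<kappa>) * D (Suc k)"
      by (simp add: algebra_simps)
    also have "\<dots> \<le> q' * D (Suc k)"
      using q'(4) pos[of "Suc k"] by (intro mult_right_mono) auto
    also have "\<dots> \<le> q' * D k"
      using q'(1) dec[of k] by simp
    finally show ?thesis .
  qed
  \<comment> \<open>Contraction by \<open>q'\<close> costs two steps, hence the square root.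
    Dividing \<open>D N\<close> by \<open>\<rho>\<close> below covers the odd start, where only
    monotonicity is used.\<close>
  define \<rho> where "\<rho> = sqrt q'"
  have \<rho>: "0 < \<rho>" "\<rho> < 1" "\<rho> * \<rho> = q'"
    using q' by (auto simp: \<rho>_def)
  have geo: "D (N + j) \<le> D N / \<rho> * \<rho> ^ j" for j
  proof (induction j rule: nat_induct2)
    case 0
    show ?case using \<rho> pos[of N] by (simp add: field_simps)
  next
    case 1
    show ?case using \<rho> dec[of N] by simp
  next
    case (step j)
    have "D (N + (j + 2)) \<le> q' * D (N + j)"
      using two_step[of "N + j"] by simp
    also have "\<dots> \<le> q' * (D N / \<rho> * \<rho> ^ j)"
      using step q'(1) by (intro mult_left_mono) auto
    also have "\<dots> = D N / \<rho> * \<rho> ^ (j + 2)"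
      unfolding \<rho>(3)[symmetric] by (simp add: power_add power2_eq_square)
    finally show ?case .
  qed
  show ?thesis
  proof (rule that[of "D N / \<rho> / \<rho> ^ N" \<rho>])
    show "\<forall>\<^sub>F k in sequentially. D k \<le> D N / \<rho> / \<rho> ^ N * \<rho> ^ k"
      using eventually_ge_at_top[of N]
    proof eventually_elim
      case (elim k)
      then show ?case
        using geo[of "k - N"] \<rho>(1) by (simp add: power_diff)
    qed
  qed (use \<rho> pos in auto)
qed

text \<open>
  The quantity \<open>D k powr (- s)\<close> grows by at least a constant in any two consecutive steps.
\<close>

lemma two_step_sublinear_rate:
  fixes D :: "nat \<Rightarrow> real"
  assumes pos: "\<And>k. 0 < D k" and dec: "\<And>k. D (Suc k) \<le> D k" and "D \<longlonglongrightarrow> 0"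
    and "0 < q" and "q < 1" and "0 < \<kappa>" and "0 < s"
    and alt: "\<forall>\<^sub>F k in sequentially. D (Suc k) \<le> q * D k \<or> \<kappa> * D (Suc k) powr (1 + s) \<le> D (Suc k) - D (Suc (Suc k))"
  obtains A where "0 < A" "\<forall>\<^sub>F k in sequentially. D k \<le> A * real k powr (- (1 / s))"
proof -
  have "\<forall>\<^sub>F k in sequentially. D k < 1"
    using \<open>D \<longlonglongrightarrow> 0\<close> by (rule order_tendstoD) simp
  from eventually_conj[OF this alt] obtain N where N: "\<And>k. k \<ge> N \<Longrightarrow> D k < 1"
      "\<And>k. k \<ge> N \<Longrightarrow> D (Suc k) \<le> q * D k \<or> \<kappa> * D (Suc k) powr (1 + s) \<le> D (Suc k) - D (Suc (Suc k))"
    unfolding eventually_sequentially by blast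
  define h where "h t = t powr (- s)" for t :: real
  have h_mono: "h u \<le> h t" if "0 < t" "t \<le> u" for t u
    unfolding h_def using that \<open>0 < s\<close> by (intro powr_mono2') auto
  have h_dec: "h (D k) \<le> h (D (Suc k))" for k
    using pos dec by (intro h_mono) auto
  \<comment> \<open>The first entry is the gain from a contraction by \<open>q\<close> when
    \<open>h (D k) \<ge> 1\<close>, the second the gain from the power recursion.\<close>
  define C where "C = min (h q - 1) (s * \<kappa>)"
  have "1 < h q"
    using \<open>0 < q\<close> \<open>q < 1\<close> \<open>0 < s\<close> using powr_less_mono2[of s q 1]
    by (simp add: h_def powr_minus one_less_inverse_iff)
  then have "0 < C"
    using assms by (simp add: C_def)
  have two_step: "h (D k) + C \<le> h (D (Suc (Suc k)))" if "k \<ge> N" for k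
    using N(2)[OF that]
  proof
    assume "D (Suc k) \<le> q * D k"
    then have "h q * h (D k) \<le> h (D (Suc k))"
      using h_mono[of "D (Suc k)" "q * D k"] pos \<open>0 < q\<close> by (simp add: h_def powr_mult)
    moreover have "1 \<le> h (D k)"
      using h_mono[of "D k" 1] pos N(1)[OF that] by (simp add: h_def less_imp_le)
    then have "(h q - 1) * 1 \<le> (h q - 1) * h (D k)"
      using \<open>1 < h q\<close> by (intro mult_left_mono) auto
    ultimately show ?thesis
      using h_dec[of "Suc k"] by (simp add: C_def algebra_simps)
  next
    assume *: "\<kappa> * D (Suc k) powr (1 + s) \<le> D (Suc k) - D (Suc (Suc k))"
    define E u where "E = D (Suc k)" and "u = \<kappa> * E powr s"
    have E: "0 < E"
      using pos by (simp add: E_def)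
    have "D (Suc (Suc k)) \<le> E * (1 - u)"
      using * E by (simp add: E_def[symmetric] u_def powr_add algebra_simps)
    \<comment> \<open>Passing from \<open>1 - u\<close> to \<open>exp (- u)\<close> turns
      \<open>h\<close> of the product into \<open>h E * exp (s * u)\<close>, which is at least
      \<open>h E * (1 + s * u)\<close>; here \<open>h E * u = \<kappa>\<close> does not depend on
      \<open>k\<close>.\<close>
    also have "\<dots> \<le> E * exp (- u)"
      using exp_ge_add_one_self[of "- u"] E by (intro mult_left_mono) auto
    finally have "h (E * exp (- u)) \<le> h (D (Suc (Suc k)))"
      using pos by (intro h_mono)
    moreover have "h (E * exp (- u)) = h E * exp (s * u)"
      using E by (simp add: h_def powr_mult exp_powr_real mult.commute)
    moreover have "h E * (1 + s * u) \<le> h E * exp (s * u)"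
      using exp_ge_add_one_self[of "s * u"] by (intro mult_left_mono) (auto simp: h_def)
    moreover have "h E * u = \<kappa> * (E powr (- s) * E powr s)"
      by (simp add: h_def u_def)
    then have "h E * u = \<kappa>"
      using E by (simp add: powr_add[symmetric])
    then have "h E * (1 + s * u) = h E + s * \<kappa>"
      by (simp add: algebra_simps)
    ultimately show ?thesis
      using h_dec[of k] by (simp add: E_def C_def)
  qed
  \<comment> \<open>The shift by one makes the left side nonpositive in both base cases.\<close>
  have lin: "C * (real j - 1) / 2 \<le> h (D (N + j))" for j
  proof (induction j rule: nat_induct2)
    case 0
    have "0 \<le> h (D N)" by (simp add: h_def)
    then show ?case using \<open>0 < C\<close> by simp
  next
    case 1
    show ?case by (simp add: h_def)
  next
    case (step j)
    then show ?case
      using two_step[of "N + j"] by (simp add: field_simps)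
  qed
  show ?thesis
  proof (rule that[of "(C / 4) powr (- (1 / s))"])
    show "0 < (C / 4) powr (- (1 / s))"
      using \<open>0 < C\<close> by simp
    \<comment> \<open>From \<open>2 * N + 2\<close> on, \<open>k - N - 1\<close> is at least
      \<open>k / 2\<close>, which absorbs the offset \<open>N\<close>.\<close>
    show "\<forall>\<^sub>F k in sequentially. D k \<le> (C / 4) powr (- (1 / s)) * real k powr (- (1 / s))"
      using eventually_ge_at_top[of "2 * N + 2"]
    proof eventually_elim
      case (elim k)
      have "real k / 2 \<le> real (k - N) - 1"
        using elim by (simp add: of_nat_diff)
      then have "C * (real k / 2) \<le> C * (real (k - N) - 1)"
        using \<open>0 < C\<close> by (intro mult_left_mono) auto
      then have "C / 4 * real k \<le> h (D k)"
        using lin[of "k - N"] elim by simp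
      moreover have "0 < C / 4 * real k"
        using \<open>0 < C\<close> elim by simp
      ultimately have "h (D k) powr (- (1 / s)) \<le> (C / 4 * real k) powr (- (1 / s))"
        using \<open>0 < s\<close> by (intro powr_mono2') auto
      moreover have "h (D k) powr (- (1 / s)) = D k"
        using pos[of k] \<open>0 < s\<close> by (simp add: h_def powr_powr)
      moreover have "(C / 4 * real k) powr (- (1 / s)) = (C / 4) powr (- (1 / s)) * real k powr (- (1 / s))"
        by (rule powr_mult)
      ultimately show ?case
        by linarith
    qed
  qed
qed

subsection \<open>Descent under a KL inequality\<close>

text \<open>The method with the manifold removed: \<open>D\<close> stands for the gap of the
  reference values, \<open>r\<close> for that of the function values and \<open>\<delta>\<close> for
  the length of the directions. \<open>descent\<close> and \<open>move\<close> are local because the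
  stepsize and retraction bounds are.\<close>

locale nonmonotone_descent =
  fixes x :: "nat \<Rightarrow> 'a::real_normed_vector" and xs :: 'a and K :: "nat \<Rightarrow> nat"
    and D r \<delta> :: "nat \<Rightarrow> real" and L c q e b :: real
  assumes D_pos: "0 < D k" and D_dec: "D (Suc k) \<le> D k" and D_lim: "D \<longlonglongrightarrow> 0"
    and params: "0 < L" "0 < c" "0 < q" "q < 1" "0 < e" "0 < b"
    and step_nonneg: "0 \<le> \<delta> k"
    and r_le: "r k \<le> D k"
    and stall: "r (Suc k) \<le> D (Suc k) / 2 \<Longrightarrow> D (Suc k) \<le> q * D k"
    and descent: "\<forall>\<^sub>F k in sequentially. norm (x k - xs) < e \<longrightarrow> c * (\<delta> k)\<^sup>2 \<le> D k - D (Suc k)"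
    and move: "\<forall>\<^sub>F k in sequentially. norm (x k - xs) < e \<longrightarrow> norm (x (Suc k) - x k) \<le> L * \<delta> k"
    and subseq: "strict_mono K" "(\<lambda>i. x (K i)) \<longlonglongrightarrow> xs"
begin

text \<open>Covers the iterates with \<open>r\<close> at most half of \<open>D\<close>: their
  direction is bounded by the root of \<open>D\<close>, which the drop of that root then
  dominates.\<close>

lemma sqrt_decrease:
  assumes "D (Suc k) \<le> q * D k"
  shows "(1 / sqrt q - 1) * sqrt (D (Suc k)) \<le> sqrt (D k) - sqrt (D (Suc k))"
proof -
  have "sqrt (D (Suc k)) \<le> sqrt q * sqrt (D k)"
    using assms by (metis real_sqrt_le_mono real_sqrt_mult)
  then have "sqrt (D (Suc k)) / sqrt q \<le> sqrt (D k)"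
    using params by (simp add: field_simps)
  then show ?thesis
    by (simp add: algebra_simps)
qed

text \<open>
  KL holds at \<open>r k\<close>, which may be much smaller than \<open>D k\<close>.  If \<open>r k > D k / 2\<close>, concavity makes the
  derivative at \<open>D k / 2\<close> at least as large, whence the argument \<open>D k / 2\<close> of \<open>\<psi>\<close> in the bound.
\<close>

lemma path_length:
  fixes \<psi> \<psi>' :: "real \<Rightarrow> real"
  assumes \<eta>: "0 < \<eta>" and e': "0 < e'"
    and cont: "continuous_on {0..\<eta>} \<psi>" and conc: "concave_on {0..\<eta>} \<psi>"
    and nonneg: "\<And>t. t \<in> {0..\<eta>} \<Longrightarrow> 0 \<le> \<psi> t" and "\<psi> 0 = 0"
    and deriv: "\<And>t. t \<in> {0<..<\<eta>} \<Longrightarrow> (\<psi> has_real_derivative \<psi>' t) (at t)"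
    and deriv_pos: "\<And>t. t \<in> {0<..<\<eta>} \<Longrightarrow> 0 < \<psi>' t"
    and KL: "\<And>k. norm (x k - xs) < e' \<Longrightarrow> 0 < r k \<Longrightarrow> r k < \<eta> \<Longrightarrow> 1 \<le> \<psi>' (r k) * (b * \<delta> k)"
  obtains A B where "0 \<le> A" "0 \<le> B" "x \<longlonglongrightarrow> xs"
    "\<forall>\<^sub>F k in sequentially. norm (x k - xs) \<le> A * sqrt (D (k - 1)) + B * \<psi> (D k / 2)"
proof -
  \<comment> \<open>\<open>A\<close> results from bounding \<open>L * \<delta> k\<close> by
    \<open>L / sqrt c * sqrt (D k)\<close> and applying \<open>sqrt_decrease\<close>; the factor 2
    in \<open>B\<close> undoes the halving of the argument of \<open>\<psi>\<close>.\<close>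
  define A where "A = L / sqrt c / (1 / sqrt q - 1)"
  define B where "B = 2 * b * L / c"
  have q1: "0 < 1 / sqrt q - 1"
    using params by simp
  have AB: "0 \<le> A" "0 \<le> B"
    using params q1 by (auto simp: A_def B_def)
  \<comment> \<open>The root is taken at \<open>k - 1\<close> because the averaging that produced
    \<open>D k\<close> reduced it relative to \<open>D (k - 1)\<close>; index 0 is excluded
    below.\<close>
  define P where "P k = A * sqrt (D (k - 1)) + B * \<psi> (D k / 2)" for k
  have D_small: "\<forall>\<^sub>F k in sequentially. D k < \<eta>"
    using D_lim \<eta> by (rule order_tendstoD)
  have psi_lim: "(\<lambda>k. \<psi> (D k / 2)) \<longlonglongrightarrow> \<psi> 0"
  proof (rule continuous_on_tendsto_compose[OF cont])
    show "(\<lambda>k. D k / 2) \<longlonglongrightarrow> 0"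
      using tendsto_divide[OF D_lim tendsto_const[of 2]] by simp
    show "\<forall>\<^sub>F k in sequentially. D k / 2 \<in> {0..\<eta>}"
      using D_small
    proof eventually_elim
      case (elim k)
      then show ?case
        using D_pos[of k] by simp
    qed
  qed (use \<eta> in auto)
  have D_lim': "(\<lambda>k. D (k - 1)) \<longlonglongrightarrow> 0"
    by (rule filterlim_compose[OF D_lim filterlim_minus_const_nat_at_top])
  have "P \<longlonglongrightarrow> A * sqrt 0 + B * \<psi> 0"
    unfolding P_def by (intro tendsto_intros D_lim' psi_lim)
  then have P_lim: "P \<longlonglongrightarrow> 0"
    using \<open>\<psi> 0 = 0\<close> by simp
  have P_nonneg: "\<forall>\<^sub>F k in sequentially. 0 \<le> P k"
    using D_small
  proof eventually_elim
    case (elim k)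
    have "D k / 2 \<in> {0..\<eta>}"
      using elim D_pos[of k] by (simp add: field_simps)
    then show ?case
      using nonneg AB D_pos[of "k - 1"] by (simp add: P_def)
  qed
  have step: "\<forall>\<^sub>F k in sequentially. norm (x k - xs) < min e e' \<longrightarrow> norm (x (Suc k) - x k) \<le> P k - P (Suc k)"
    using D_small descent move eventually_gt_at_top[of 0]
  proof (eventually_elim, intro impI)
    fix k assume small: "D k < \<eta>" and d: "norm (x k - xs) < e \<longrightarrow> c * (\<delta> k)\<^sup>2 \<le> D k - D (Suc k)"
      and m: "norm (x k - xs) < e \<longrightarrow> norm (x (Suc k) - x k) \<le> L * \<delta> k" and "0 < k"
      and near: "norm (x k - xs) < min e e'"
    then obtain j where j: "k = Suc j"
      using gr0_implies_Suc by blast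
    have d: "c * (\<delta> k)\<^sup>2 \<le> D k - D (Suc k)" and m: "norm (x (Suc k) - x k) \<le> L * \<delta> k"
      using d m near by auto
    have t: "D k / 2 \<in> {0<..<\<eta>}" "D (Suc k) / 2 \<in> {0..\<eta>}"
      using small D_pos[of k] D_pos[of "Suc k"] D_dec[of k] by auto
    have psi: "\<psi>' (D k / 2) * (D k - D (Suc k)) / 2 \<le> \<psi> (D k / 2) - \<psi> (D (Suc k) / 2)"
      using concave_on_tangent[OF conc deriv[OF t(1)] t] by (simp add: field_simps)
    have psi_dec: "0 \<le> B * (\<psi> (D k / 2) - \<psi> (D (Suc k) / 2))"
    proof -
      have "0 \<le> \<psi>' (D k / 2) * (D k - D (Suc k)) / 2"
        using deriv_pos[OF t(1)] D_dec[of k] by simp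
      then show ?thesis
        using psi AB by (intro mult_nonneg_nonneg) linarith+
    qed
    have sqrt_dec: "0 \<le> A * (sqrt (D j) - sqrt (D k))"
      using AB D_dec[of j] j by (intro mult_nonneg_nonneg) auto
    have "L * \<delta> k \<le> A * (sqrt (D j) - sqrt (D k)) + B * (\<psi> (D k / 2) - \<psi> (D (Suc k) / 2))"
    proof (cases "r k \<le> D k / 2")
      case True
      have "sqrt c * \<delta> k \<le> sqrt (D k)"
      proof (rule real_le_rsqrt)
        show "(sqrt c * \<delta> k)\<^sup>2 \<le> D k"
          using d D_pos[of "Suc k"] params by (simp add: power_mult_distrib)
      qed
      then have "L * \<delta> k \<le> L / sqrt c * sqrt (D k)"
        using params by (simp add: field_simps)
      also have "\<dots> = A * ((1 / sqrt q - 1) * sqrt (D k))"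
        using q1 nonzero_eq_divide_eq[of "1 / sqrt q - 1" A "L / sqrt c"] by (metis A_def less_irrefl mult.assoc)
      also have "\<dots> \<le> A * (sqrt (D j) - sqrt (D k))"
        using sqrt_decrease stall True AB j by (intro mult_left_mono) auto
      finally show ?thesis
        using psi_dec by simp
    next
      case False
      then have r: "0 < r k" "D k / 2 \<le> r k" "r k < \<eta>"
        using D_pos[of k] r_le[of k] small by auto
      have KLk: "1 \<le> \<psi>' (D k / 2) * (b * \<delta> k)"
      proof -
        have "\<psi>' (r k) \<le> \<psi>' (D k / 2)"
          by (rule concave_on_deriv_antimono[OF conc deriv]) (use r t in auto)
        then have "\<psi>' (r k) * (b * \<delta> k) \<le> \<psi>' (D k / 2) * (b * \<delta> k)"
          using params step_nonneg by (intro mult_right_mono) auto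
        then show ?thesis
          using KL[of k] r near by simp
      qed
      \<comment> \<open>Multiplying by the KL product, which is at least 1, turns
        \<open>\<delta> k\<close> into its square, the quantity controlled by
        \<open>descent\<close>.\<close>
      have "L * \<delta> k * 1 \<le> L * \<delta> k * (\<psi>' (D k / 2) * (b * \<delta> k))"
        using KLk params step_nonneg by (intro mult_left_mono) auto
      also have "\<dots> = B * (\<psi>' (D k / 2) * (c * (\<delta> k)\<^sup>2) / 2)"
        using params by (simp add: B_def power2_eq_square)
      also have "\<dots> \<le> B * (\<psi>' (D k / 2) * (D k - D (Suc k)) / 2)"
        using d deriv_pos[OF t(1)] AB by (intro mult_left_mono divide_right_mono) auto
      also have "\<dots> \<le> B * (\<psi> (D k / 2) - \<psi> (D (Suc k) / 2))"
        using psi AB by (intro mult_left_mono)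
      finally show ?thesis
        using sqrt_dec by simp
    qed
    then show "norm (x (Suc k) - x k) \<le> P k - P (Suc k)"
      using m by (simp add: P_def j algebra_simps)
  qed
  have "0 < min e e'"
    using e' params by simp
  from LIMSEQ_trap[OF this step P_lim P_nonneg subseq] show ?thesis
    using that AB unfolding P_def by blast
qed

section \<open>Rates for power-type desingularization functions\<close>

text \<open>With derivative \<open>C * t powr (\<theta> - 1)\<close>, KL bounds
  \<open>\<delta> k\<close> below by a multiple of \<open>r k powr (1 - \<theta>)\<close>. Where
  \<open>r k\<close> exceeds \<open>D k / 2\<close>, squaring and \<open>descent\<close> give the
  power recursion; elsewhere \<open>stall\<close> gives the contraction.\<close>

lemma power_alternative:
  assumes \<eta>: "0 < \<eta>" and e': "0 < e'" and C: "0 < C" and \<theta>: "0 < \<theta>" "\<theta> < 1"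
    and KL: "\<And>k. norm (x k - xs) < e' \<Longrightarrow> 0 < r k \<Longrightarrow> r k < \<eta> \<Longrightarrow> 1 \<le> C * r k powr (\<theta> - 1) * (b * \<delta> k)"
    and lim: "x \<longlonglongrightarrow> xs"
  obtains \<kappa> where "0 < \<kappa>" "\<forall>\<^sub>F k in sequentially. D (Suc k) \<le> q * D k \<or>
      \<kappa> * D (Suc k) powr (2 * (1 - \<theta>)) \<le> D (Suc k) - D (Suc (Suc k))"
proof -
  define \<kappa> where "\<kappa> = c * ((1/2) powr (1 - \<theta>) / (C * b))\<^sup>2"
  have "\<forall>\<^sub>F k in sequentially. norm (x k - xs) < min e e'"
    using tendstoD[OF lim, of "min e e'"] e' params by (simp add: dist_norm)
  moreover have "\<forall>\<^sub>F k in sequentially. D k < \<eta>"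
    using D_lim \<eta> by (rule order_tendstoD)
  ultimately have "\<forall>\<^sub>F k in sequentially. r k \<le> D k / 2 \<or> \<kappa> * D k powr (2 * (1 - \<theta>)) \<le> D k - D (Suc k)"
    using descent
  proof (eventually_elim, intro disjCI)
    fix k assume near: "norm (x k - xs) < min e e'" and small: "D k < \<eta>"
      and d: "norm (x k - xs) < e \<longrightarrow> c * (\<delta> k)\<^sup>2 \<le> D k - D (Suc k)"
      and alt: "\<not> \<kappa> * D k powr (2 * (1 - \<theta>)) \<le> D k - D (Suc k)"
    show "r k \<le> D k / 2"
    proof (rule ccontr)
      assume "\<not> r k \<le> D k / 2"
      then have r: "0 < r k" "D k / 2 \<le> r k" "r k < \<eta>"
        using D_pos[of k] r_le[of k] small by auto
      have "(D k / 2) powr (1 - \<theta>) \<le> r k powr (1 - \<theta>)"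
        using r D_pos[of k] \<theta> by (intro powr_mono2) auto
      also have "\<dots> \<le> r k powr (1 - \<theta>) * (C * r k powr (\<theta> - 1) * (b * \<delta> k))"
        using mult_left_mono[OF KL[of k], of "r k powr (1 - \<theta>)"] r near by simp
      also have "\<dots> = (r k powr (1 - \<theta>) * r k powr (\<theta> - 1)) * (C * b * \<delta> k)"
        by simp
      also have "\<dots> = C * b * \<delta> k"
        using r by (simp add: powr_add[symmetric])
      finally have "(D k / 2) powr (1 - \<theta>) / (C * b) \<le> \<delta> k"
        using C params by (simp add: field_simps)
      then have "((D k / 2) powr (1 - \<theta>) / (C * b))\<^sup>2 \<le> (\<delta> k)\<^sup>2"
        using C params by (intro power_mono) auto
      then have "c * ((D k / 2) powr (1 - \<theta>) / (C * b))\<^sup>2 \<le> c * (\<delta> k)\<^sup>2"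
        using params by (intro mult_left_mono) auto
      moreover have "\<kappa> * D k powr (2 * (1 - \<theta>)) = c * ((D k / 2) powr (1 - \<theta>) / (C * b))\<^sup>2"
      proof -
        have "D k powr (2 * (1 - \<theta>)) = (D k powr (1 - \<theta>))\<^sup>2"
          using D_pos[of k] by (simp add: powr_power mult.commute)
        moreover have "(D k / 2) powr (1 - \<theta>) = D k powr (1 - \<theta>) * (1/2) powr (1 - \<theta>)"
          using powr_mult[of "D k" "1/2" "1 - \<theta>"] D_pos[of k] by simp
        ultimately show ?thesis
          by (simp add: \<kappa>_def power_mult_distrib power_divide)
      qed
      ultimately show False
        using d near alt by simp
    qed
  qed
  \<comment> \<open>\<open>stall\<close> compares an index with its predecessor, hence the shift by
    one.\<close>
  then have "\<forall>\<^sub>F k in sequentially. r (Suc k) \<le> D (Suc k) / 2 \<or>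
      \<kappa> * D (Suc k) powr (2 * (1 - \<theta>)) \<le> D (Suc k) - D (Suc (Suc k))"
    by (rule eventually_compose_filterlim[OF _ filterlim_Suc])
  then have "\<forall>\<^sub>F k in sequentially. D (Suc k) \<le> q * D k \<or>
      \<kappa> * D (Suc k) powr (2 * (1 - \<theta>)) \<le> D (Suc k) - D (Suc (Suc k))"
    by eventually_elim (use stall in blast)
  moreover have "0 < \<kappa>"
    using params C by (simp add: \<kappa>_def)
  ultimately show ?thesis
    using that by blast
qed

lemma D_pred_le: "D k \<le> D (k - 1)"
  using D_dec[of "k - 1"] by (cases k) auto

text \<open>Eventually \<open>D\<close> is below 1, so the smaller of the exponents
  \<open>1/2\<close> and \<open>\<theta>\<close> dominates, and monotonicity moves the
  \<open>\<theta>\<close> term from \<open>k\<close> to \<open>k - 1\<close>.\<close>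

lemma iterate_bound:
  assumes AB: "0 \<le> A" "0 \<le> B" and C: "0 < C" and \<theta>: "0 < \<theta>"
    and bound: "\<forall>\<^sub>F k in sequentially. norm (x k - xs) \<le> A * sqrt (D (k - 1)) + B * (C * (D k / 2) powr \<theta>)"
  shows "\<forall>\<^sub>F k in sequentially. norm (x k - xs) \<le> (A + B * C) * D (k - 1) powr min (1/2) \<theta>"
proof -
  have "(\<lambda>k. D (k - 1)) \<longlonglongrightarrow> 0"
    by (rule filterlim_compose[OF D_lim filterlim_minus_const_nat_at_top])
  then have "\<forall>\<^sub>F k in sequentially. D (k - 1) < 1"
    by (rule order_tendstoD) simp
  with bound show ?thesis
  proof eventually_elim
    case (elim k)
    have D: "0 < D (k - 1)"
      by (rule D_pos)
    have "sqrt (D (k - 1)) \<le> D (k - 1) powr min (1/2) \<theta>"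
      using D elim by (subst powr_half_sqrt[symmetric]) (auto intro!: powr_mono')
    moreover have "(D k / 2) powr \<theta> \<le> D (k - 1) powr min (1/2) \<theta>"
    proof -
      have "(D k / 2) powr \<theta> \<le> D (k - 1) powr \<theta>"
        using \<theta> D_pos[of k] D_pred_le[of k] by (intro powr_mono2) auto
      also have "\<dots> \<le> D (k - 1) powr min (1/2) \<theta>"
        using D elim by (intro powr_mono') auto
      finally show ?thesis .
    qed
    ultimately have "A * sqrt (D (k - 1)) + B * (C * (D k / 2) powr \<theta>)
        \<le> A * D (k - 1) powr min (1/2) \<theta> + B * (C * D (k - 1) powr min (1/2) \<theta>)"
      using AB C by (intro add_mono mult_left_mono) auto
    also have "\<dots> = (A + B * C) * D (k - 1) powr min (1/2) \<theta>"
      by (simp add: algebra_simps)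
    finally show ?case
      using elim by linarith
  qed
qed

text \<open>For \<open>\<theta> \<ge> 1/2\<close> the exponent \<open>2 * (1 - \<theta>)\<close> is
  at most 1, the linear regime. The iterates inherit the square root of the rate of
  \<open>D\<close>.\<close>

lemma linear_rate:
  assumes "0 < \<kappa>" and "1/2 \<le> \<theta>" and "0 \<le> A"
    and alt: "\<forall>\<^sub>F k in sequentially. D (Suc k) \<le> q * D k \<or>
      \<kappa> * D (Suc k) powr (2 * (1 - \<theta>)) \<le> D (Suc k) - D (Suc (Suc k))"
    and bound: "\<forall>\<^sub>F k in sequentially. norm (x k - xs) \<le> A * D (k - 1) powr min (1/2) \<theta>"
  shows "R_linear D 0" and "R_linear x xs"
proof -
  obtain E \<rho> where E: "0 < E" and \<rho>: "0 < \<rho>" "\<rho> < 1"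
    and rate: "\<forall>\<^sub>F k in sequentially. D k \<le> E * \<rho> ^ k"
    using two_step_linear_rate[OF D_pos D_dec D_lim params(3,4) assms(1) _ alt] assms(2) by auto
  have "\<forall>\<^sub>F k in sequentially. norm (D k - 0) \<le> E * \<rho> ^ k"
    using rate
  proof eventually_elim
    case (elim k)
    then show ?case
      using D_pos[of k] by simp
  qed
  then show "R_linear D 0"
    using E \<rho> by (rule R_linearI)
  have "\<forall>\<^sub>F k in sequentially. D (k - 1) \<le> E * \<rho> ^ (k - 1)"
    by (rule eventually_compose_filterlim[OF rate filterlim_minus_const_nat_at_top])
  with bound eventually_gt_at_top[of 0]
  have "\<forall>\<^sub>F k in sequentially. norm (x k - xs) \<le> (A + 1) * sqrt (E / \<rho>) * sqrt \<rho> ^ k"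
  proof eventually_elim
    case (elim k)
    have "min (1/2) \<theta> = 1/2"
      using assms(2) by simp
    then have "norm (x k - xs) \<le> A * sqrt (D (k - 1))"
      using elim(1) D_pos[of "k - 1"] by (simp add: powr_half_sqrt less_imp_le)
    \<comment> \<open>Using \<open>A + 1\<close> keeps the prefactor positive, as
      \<open>R_linearI\<close> demands.\<close>
    also have "\<dots> \<le> (A + 1) * sqrt (D (k - 1))"
      using D_pos[of "k - 1"] by (intro mult_right_mono) auto
    also have "\<dots> \<le> (A + 1) * sqrt (E * \<rho> ^ (k - 1))"
      using elim \<open>0 \<le> A\<close> by (intro mult_left_mono) auto
    also have "E * \<rho> ^ (k - 1) = E / \<rho> * \<rho> ^ k"
      using elim \<rho> by (cases k) auto
    also have "(A + 1) * sqrt (E / \<rho> * \<rho> ^ k) = (A + 1) * sqrt (E / \<rho>) * sqrt \<rho> ^ k"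
      by (simp only: real_sqrt_mult real_sqrt_power mult.assoc)
    finally show ?case .
  qed
  then show "R_linear x xs"
    using \<open>0 \<le> A\<close> E \<rho> by (intro R_linearI[where A = "(A + 1) * sqrt (E / \<rho>)" and \<rho> = "sqrt \<rho>"]) auto
qed

text \<open>With \<open>s = 1 - 2 * \<theta>\<close> the exponent \<open>2 * (1 - \<theta>)\<close>
  is \<open>1 + s\<close>, the sublinear regime. The iterates decay like \<open>D\<close> to the
  power \<open>\<theta>\<close>.\<close>

lemma sublinear_rate:
  assumes "0 < \<kappa>" and \<theta>: "0 < \<theta>" "\<theta> < 1/2" and "0 \<le> A"
    and alt: "\<forall>\<^sub>F k in sequentially. D (Suc k) \<le> q * D k \<or>
      \<kappa> * D (Suc k) powr (2 * (1 - \<theta>)) \<le> D (Suc k) - D (Suc (Suc k))"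
    and bound: "\<forall>\<^sub>F k in sequentially. norm (x k - xs) \<le> A * D (k - 1) powr min (1/2) \<theta>"
  shows "\<exists>\<eta>1>0. \<exists>\<eta>2>0. \<forall>\<^sub>F k in sequentially.
           D k \<le> \<eta>1 * real k powr (- (1 / (1 - 2 * \<theta>))) \<and>
           norm (x k - xs) \<le> \<eta>2 * real k powr (- (\<theta> / (1 - 2 * \<theta>)))"
proof -
  define s where "s = 1 - 2 * \<theta>"
  have s: "0 < s" "2 * (1 - \<theta>) = 1 + s"
    using \<theta> by (auto simp: s_def)
  obtain E where E: "0 < E" and rate: "\<forall>\<^sub>F k in sequentially. D k \<le> E * real k powr (- (1 / s))"
    using two_step_sublinear_rate[OF D_pos D_dec D_lim params(3,4) assms(1) s(1) alt[unfolded s(2)]] by blast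
  \<comment> \<open>The power of \<open>1/2\<close> comes from \<open>k - 1 \<ge> k / 2\<close> for
    \<open>k \<ge> 2\<close>.\<close>
  define F where "F = (A + 1) * (E powr \<theta> * (1/2) powr (- (\<theta> / s)))"
  have "\<forall>\<^sub>F k in sequentially. D (k - 1) \<le> E * real (k - 1) powr (- (1 / s))"
    by (rule eventually_compose_filterlim[OF rate filterlim_minus_const_nat_at_top])
  with bound eventually_ge_at_top[of 2]
  have "\<forall>\<^sub>F k in sequentially. norm (x k - xs) \<le> F * real k powr (- (\<theta> / s))"
  proof eventually_elim
    case (elim k)
    have "norm (x k - xs) \<le> A * D (k - 1) powr \<theta>"
      using elim(1) \<theta> by (simp add: min_def)
    also have "\<dots> \<le> (A + 1) * D (k - 1) powr \<theta>"
      by (intro mult_right_mono) auto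
    also have "\<dots> \<le> (A + 1) * (E powr \<theta> * (1/2) powr (- (\<theta> / s)) * real k powr (- (\<theta> / s)))"
    proof (intro mult_left_mono)
      have "D (k - 1) powr \<theta> \<le> (E * real (k - 1) powr (- (1 / s))) powr \<theta>"
        using elim \<theta> D_pos[of "k - 1"] by (intro powr_mono2) auto
      also have "\<dots> = E powr \<theta> * real (k - 1) powr (- (\<theta> / s))"
        using E by (simp add: powr_mult powr_powr)
      also have "\<dots> \<le> E powr \<theta> * (1/2 * real k) powr (- (\<theta> / s))"
        using elim s \<theta> by (intro mult_left_mono powr_mono2') auto
      also have "(1/2 * real k) powr (- (\<theta> / s)) = (1/2) powr (- (\<theta> / s)) * real k powr (- (\<theta> / s))"
        by (rule powr_mult)
      finally show "D (k - 1) powr \<theta> \<le> E powr \<theta> * (1/2) powr (- (\<theta> / s)) * real k powr (- (\<theta> / s))"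
        by (simp only: mult.assoc)
    qed (use \<open>0 \<le> A\<close> in simp)
    finally show ?case
      by (simp only: F_def mult.assoc)
  qed
  moreover have "0 < F"
    using \<open>0 \<le> A\<close> E by (simp add: F_def)
  ultimately show ?thesis
    using E rate unfolding s_def[symmetric] by (intro exI[of _ E] exI[of _ F] conjI eventually_conj)
qed

end

subsection \<open>Runs of the nonmonotone subgradient method\<close>

locale nonmonotone_subgradient_method =
  fixes M :: "'a::euclidean_space set"
    and R :: "'a \<Rightarrow> 'a \<Rightarrow> 'a"
    and \<phi> :: "'a \<Rightarrow> real"
    and x w d :: "nat \<Rightarrow> 'a"
    and \<tau> p Ref :: "nat \<Rightarrow> real"
    and \<tau>min \<tau>max \<sigma> \<beta> pmin a b :: real
    and xs :: 'a and K :: "nat \<Rightarrow> nat"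
  assumes submanifold: "embedded_submanifold M"
    and retraction: "manifold_retraction M R"
    and cont: "continuous_on M \<phi>"
    and loc_bounded: "locally_bounded_on M (proj_subdifferential M \<phi>)"
    and upper_quadratic: "\<forall>xb\<in>M. \<exists>\<kappa>>0. \<exists>r>0. \<exists>V. openin (top_of_set M) V \<and> xb \<in> V \<and>
           (\<forall>y\<in>V. \<forall>\<xi>\<in>tangent_space M y. norm \<xi> \<le> r \<longrightarrow>
             (\<forall>v\<in>proj_subdifferential M \<phi> y.
                \<phi> (R y \<xi>) - (\<phi> y + v \<bullet> \<xi>) \<le> \<kappa> * (norm \<xi>)\<^sup>2))"
    and \<tau>min: "0 < \<tau>min" and "\<tau>min \<le> \<tau>max"
    and \<sigma>: "\<sigma> \<in> {0<..<1}" and \<beta>: "\<beta> \<in> {0<..<1}" and pmin: "pmin \<in> {0<..1}"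
    and a: "0 < a" and b: "0 < b"
    and run: "nonmonotone_subgradient_run M R \<phi> \<tau>min \<tau>max \<sigma> \<beta> pmin a b x w d \<tau> p Ref"
    and K: "strict_mono K" and lim_K: "(\<lambda>i. x (K i)) \<longlonglongrightarrow> xs" and xs: "xs \<in> M"
begin

lemma
  shows x_0: "x 0 \<in> M" and Ref_0: "Ref 0 = \<phi> (x 0)"
    and w_proj: "w k \<in> proj_subdifferential M \<phi> (x k)"
    and d_tangent: "d k \<in> tangent_space M (x k)" and d_nonzero: "d k \<noteq> 0"
    and w_d: "w k \<bullet> d k \<le> - a * (norm (d k))\<^sup>2"
    and norm_w: "norm (w k) \<le> b * norm (d k)"
    and backtracking: "backtracking_step
            (\<lambda>t. \<phi> (R (x k) (t *\<^sub>R d k)) \<le> Ref k + \<sigma> * t * (w k \<bullet> d k)) \<beta> \<tau>min \<tau>max (\<tau> k)"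
    and x_Suc: "x (Suc k) = R (x k) (\<tau> k *\<^sub>R d k)"
    and p: "p (Suc k) \<in> {pmin..1}"
    and Ref_Suc: "Ref (Suc k) = (1 - p (Suc k)) * Ref k + p (Suc k) * \<phi> (x (Suc k))"
  using run by (auto simp: nonmonotone_subgradient_run_def)

section \<open>Descent and limit of the reference values\<close>

lemma x_in_M: "x k \<in> M"
proof (induction k)
  case (Suc k)
  then have "(x k, \<tau> k *\<^sub>R d k) \<in> tangent_bundle M"
    using tangent_space_scaleR[OF d_tangent] by (auto simp: tangent_bundle_def)
  then show ?case
    using retraction unfolding manifold_retraction_def x_Suc by blast
qed (rule x_0)

lemma \<tau>_bounds: "0 < \<tau> k" "\<tau> k \<le> \<tau>max"
proof -
  obtain t0 j where t: "t0 \<in> {\<tau>min..\<tau>max}" "\<tau> k = \<beta> ^ j * t0"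
    using backtracking[of k] by (auto simp: backtracking_step_def)
  then show "0 < \<tau> k"
    using \<beta> \<tau>min by simp
  have "\<beta> ^ j \<le> 1"
    using \<beta> by (intro power_le_one) auto
  then have "\<beta> ^ j * t0 \<le> 1 * t0"
    using t(1) \<tau>min by (intro mult_right_mono) auto
  then show "\<tau> k \<le> \<tau>max"
    using t by simp
qed

lemma \<phi>_decrease: "\<phi> (x (Suc k)) \<le> Ref k - \<sigma> * a * (\<tau> k * (norm (d k))\<^sup>2)"
proof -
  have "\<phi> (x (Suc k)) \<le> Ref k + \<sigma> * \<tau> k * (w k \<bullet> d k)"
    using backtracking[of k] by (auto simp: backtracking_step_def x_Suc)
  also have "\<sigma> * \<tau> k * (w k \<bullet> d k) \<le> \<sigma> * \<tau> k * (- a * (norm (d k))\<^sup>2)"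
    using w_d \<sigma> \<tau>_bounds(1)[of k] by (intro mult_left_mono) auto
  finally show ?thesis
    by (simp add: algebra_simps)
qed

lemma Ref_decrease: "Ref (Suc k) \<le> Ref k - pmin * \<sigma> * a * (\<tau> k * (norm (d k))\<^sup>2)"
proof -
  have nonneg: "0 \<le> \<sigma> * a * (\<tau> k * (norm (d k))\<^sup>2)"
    using \<sigma> a \<tau>_bounds(1)[of k] by simp
  have "Ref (Suc k) = Ref k - p (Suc k) * (Ref k - \<phi> (x (Suc k)))"
    by (simp add: Ref_Suc algebra_simps)
  also have "\<dots> \<le> Ref k - pmin * (\<sigma> * a * (\<tau> k * (norm (d k))\<^sup>2))"
    using \<phi>_decrease[of k] p[of k] pmin nonneg by (intro diff_left_mono mult_mono) auto
  finally show ?thesis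
    by (simp add: mult.assoc)
qed

lemma Ref_strict: "Ref (Suc k) < Ref k"
proof -
  have "0 < pmin * \<sigma> * a * (\<tau> k * (norm (d k))\<^sup>2)"
    using pmin \<sigma> a \<tau>_bounds(1)[of k] d_nonzero[of k] by simp
  then show ?thesis
    using Ref_decrease[of k] by linarith
qed

text \<open>\<open>Ref (Suc k)\<close> averages \<open>Ref k\<close> and
  \<open>\<phi> (x (Suc k))\<close>, and the acceptance test gives
  \<open>\<phi> (x (Suc k)) \<le> Ref k\<close>.\<close>

lemma \<phi>_le_Ref: "\<phi> (x k) \<le> Ref k"
proof (cases k)
  case (Suc j)
  have "0 \<le> \<sigma> * a * (\<tau> j * (norm (d j))\<^sup>2)"
    using \<sigma> a \<tau>_bounds(1)[of j] by simp
  then have "\<phi> (x (Suc j)) \<le> Ref j"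
    using \<phi>_decrease[of j] by linarith
  then have "(1 - p (Suc j)) * \<phi> (x (Suc j)) \<le> (1 - p (Suc j)) * Ref j"
    using p[of j] by (intro mult_left_mono) auto
  then show ?thesis
    by (simp add: Suc Ref_Suc algebra_simps)
qed (simp add: Ref_0)

lemma decseq_Ref: "decseq Ref"
  by (intro decseq_SucI less_imp_le Ref_strict)

lemma \<phi>_lim_K: "(\<lambda>i. \<phi> (x (K i))) \<longlonglongrightarrow> \<phi> xs"
  by (rule continuous_on_tendsto_compose[OF cont lim_K xs]) (simp add: x_in_M)

text \<open>\<open>Ref k\<close> dominates \<open>\<phi>\<close> at all later points of the
  subsequence, whose values tend to \<open>\<phi> xs\<close>.\<close>

lemma Ref_ge: "\<phi> xs \<le> Ref k"
proof (rule tendsto_upperbound[OF \<phi>_lim_K])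
  have "\<forall>\<^sub>F i in sequentially. k \<le> K i"
    using filterlim_subseq[OF K] by (simp add: filterlim_at_top)
  then show "\<forall>\<^sub>F i in sequentially. \<phi> (x (K i)) \<le> Ref k"
  proof eventually_elim
    case (elim i)
    then show ?case
      using decseqD[OF decseq_Ref elim] \<phi>_le_Ref[of "K i"] by linarith
  qed
qed simp

text \<open>Since the weights are at least \<open>pmin\<close>, the difference
  \<open>Ref k - \<phi> (x (Suc k))\<close> is at most the drop of \<open>Ref\<close> divided by
  \<open>pmin\<close>. Both sequences thus share a limit, and the subsequence identifies it.\<close>

lemma Ref_gap_lim: "(\<lambda>k. Ref k - Ref (Suc k)) \<longlonglongrightarrow> 0"
  and Ref_lim: "Ref \<longlonglongrightarrow> \<phi> xs"
proof -
  obtain l where l: "Ref \<longlonglongrightarrow> l"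
    using decseq_convergent[OF decseq_Ref] Ref_ge by metis
  show gap: "(\<lambda>k. Ref k - Ref (Suc k)) \<longlonglongrightarrow> 0"
    using tendsto_diff[OF l LIMSEQ_Suc[OF l]] by simp
  have nonneg: "0 \<le> Ref k - \<phi> (x (Suc k))" for k
    using \<phi>_le_Ref[of "Suc k"] Ref_strict[of k] by linarith
  have "(\<lambda>k. Ref k - \<phi> (x (Suc k))) \<longlonglongrightarrow> 0"
  proof (rule tendsto_sandwich[where f = "\<lambda>_. 0"])
    have "Ref k - \<phi> (x (Suc k)) \<le> (Ref k - Ref (Suc k)) / pmin" for k
    proof -
      have "pmin * (Ref k - \<phi> (x (Suc k))) \<le> p (Suc k) * (Ref k - \<phi> (x (Suc k)))"
        using p[of k] nonneg[of k] by (intro mult_right_mono) auto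
      also have "\<dots> = Ref k - Ref (Suc k)"
        by (simp add: Ref_Suc algebra_simps)
      finally show ?thesis
        using pmin by (simp add: pos_le_divide_eq mult.commute)
    qed
    then show "\<forall>\<^sub>F k in sequentially. Ref k - \<phi> (x (Suc k)) \<le> (Ref k - Ref (Suc k)) / pmin"
      by (intro always_eventually allI)
    show "(\<lambda>k. (Ref k - Ref (Suc k)) / pmin) \<longlonglongrightarrow> 0"
      using tendsto_divide[OF gap tendsto_const[of pmin]] pmin by simp
    show "\<forall>\<^sub>F k in sequentially. 0 \<le> Ref k - \<phi> (x (Suc k))"
      by (intro always_eventually allI nonneg)
  qed simp
  then have "(\<lambda>k. Ref k - (Ref k - \<phi> (x (Suc k)))) \<longlonglongrightarrow> l - 0"
    by (intro tendsto_diff l)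
  then have "(\<lambda>k. \<phi> (x (Suc k))) \<longlonglongrightarrow> l"
    by simp
  then have "(\<lambda>k. \<phi> (x k)) \<longlonglongrightarrow> l"
    by (rule LIMSEQ_imp_Suc)
  then have "(\<lambda>i. \<phi> (x (K i))) \<longlonglongrightarrow> l"
    by (rule filterlim_compose[OF _ filterlim_subseq[OF K]])
  then show "Ref \<longlonglongrightarrow> \<phi> xs"
    using l \<phi>_lim_K LIMSEQ_unique by blast
qed

text \<open>The drop of \<open>Ref\<close> controls \<open>\<tau> k * (norm (d k))\<^sup>2\<close>,
  and one further factor \<open>\<tau> k \<le> \<tau>max\<close> makes this the squared length. This
  covers the whole sequence, not only iterates near \<open>xs\<close>.\<close>

lemma step_lim: "(\<lambda>k. norm (\<tau> k *\<^sub>R d k)) \<longlonglongrightarrow> 0"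
proof -
  let ?C = "\<tau>max / (pmin * \<sigma> * a)"
  have "(\<lambda>k. (norm (\<tau> k *\<^sub>R d k))\<^sup>2) \<longlonglongrightarrow> 0"
  proof (rule tendsto_sandwich[where f = "\<lambda>_. 0"])
    have "(norm (\<tau> k *\<^sub>R d k))\<^sup>2 \<le> ?C * (Ref k - Ref (Suc k))" for k
    proof -
      have "pmin * \<sigma> * a * (\<tau> k * (norm (d k))\<^sup>2) \<le> Ref k - Ref (Suc k)"
        using Ref_decrease[of k] by simp
      then have "\<tau> k * (norm (d k))\<^sup>2 \<le> (Ref k - Ref (Suc k)) / (pmin * \<sigma> * a)"
        using pmin \<sigma> a by (simp add: field_simps)
      then have "\<tau>max * (\<tau> k * (norm (d k))\<^sup>2) \<le> \<tau>max * ((Ref k - Ref (Suc k)) / (pmin * \<sigma> * a))"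
        using \<tau>_bounds[of k] by (intro mult_left_mono) auto
      moreover have "\<tau> k * (\<tau> k * (norm (d k))\<^sup>2) \<le> \<tau>max * (\<tau> k * (norm (d k))\<^sup>2)"
        using \<tau>_bounds[of k] by (intro mult_right_mono) auto
      moreover have "(norm (\<tau> k *\<^sub>R d k))\<^sup>2 = \<tau> k * (\<tau> k * (norm (d k))\<^sup>2)"
        by (simp add: power2_eq_square)
      moreover have "?C * (Ref k - Ref (Suc k)) = \<tau>max * ((Ref k - Ref (Suc k)) / (pmin * \<sigma> * a))"
        by simp
      ultimately show ?thesis
        by linarith
    qed
    then show "\<forall>\<^sub>F k in sequentially. (norm (\<tau> k *\<^sub>R d k))\<^sup>2 \<le> ?C * (Ref k - Ref (Suc k))"
      by simp
    show "(\<lambda>k. ?C * (Ref k - Ref (Suc k))) \<longlonglongrightarrow> 0"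
      using tendsto_mult[OF tendsto_const[of ?C] Ref_gap_lim] by simp
  qed simp_all
  then have "(\<lambda>k. sqrt ((norm (\<tau> k *\<^sub>R d k))\<^sup>2)) \<longlonglongrightarrow> sqrt 0"
    by (rule tendsto_real_sqrt)
  then show ?thesis
    by simp
qed

section \<open>Stepsizes near the limit point\<close>

lemma norm_d: "a * norm (d k) \<le> norm (w k)"
proof -
  have "a * (norm (d k))\<^sup>2 \<le> norm (w k) * norm (d k)"
    using w_d[of k] Cauchy_Schwarz_ineq2[of "w k" "d k"] by simp
  then have "(a * norm (d k)) * norm (d k) \<le> norm (w k) * norm (d k)"
    by (simp add: power2_eq_square mult.assoc)
  then show ?thesis
    using d_nonzero[of k] by simp
qed

text \<open>Near \<open>xs\<close> every positive stepsize up to some \<open>m\<close> is accepted,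
  because the fraction \<open>1 - \<sigma>\<close> of the linear decrease absorbs the quadratic
  error. A rejected trial therefore exceeds \<open>m\<close>, so backtracking cannot go below
  \<open>\<beta> * m\<close>.\<close>

lemma stepsize_lower_bound:
  obtains \<tau>low e where "0 < \<tau>low" "0 < e" "\<And>k. norm (x k - xs) < e \<Longrightarrow> \<tau>low \<le> \<tau> k"
proof -
  have near: "\<exists>e>0. \<forall>y\<in>M. norm (y - xs) < e \<longrightarrow> y \<in> V" if "openin (top_of_set M) V" "xs \<in> V" for V
    using that unfolding openin_euclidean_subtopology_iff by (auto simp: dist_norm)
  obtain V1 where V1: "openin (top_of_set M) V1" "xs \<in> V1"
    and "bounded (\<Union>y\<in>V1. proj_subdifferential M \<phi> y)"
    using loc_bounded xs unfolding locally_bounded_on_def by blast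
  then obtain B where B: "\<And>y v. y \<in> V1 \<Longrightarrow> v \<in> proj_subdifferential M \<phi> y \<Longrightarrow> norm v \<le> B"
    unfolding bounded_iff by blast
  obtain \<kappa> r V2 where "0 < \<kappa>" "0 < r" and V2: "openin (top_of_set M) V2" "xs \<in> V2"
    and quad: "\<forall>y\<in>V2. \<forall>\<xi>\<in>tangent_space M y. norm \<xi> \<le> r \<longrightarrow>
      (\<forall>v\<in>proj_subdifferential M \<phi> y. \<phi> (R y \<xi>) - (\<phi> y + v \<bullet> \<xi>) \<le> \<kappa> * (norm \<xi>)\<^sup>2)"
    using bspec[OF upper_quadratic xs] by blast
  obtain e1 where e1: "0 < e1" "\<And>y. y \<in> M \<Longrightarrow> norm (y - xs) < e1 \<Longrightarrow> y \<in> V1"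
    using near[OF V1] by blast
  obtain e2 where e2: "0 < e2" "\<And>y. y \<in> M \<Longrightarrow> norm (y - xs) < e2 \<Longrightarrow> y \<in> V2"
    using near[OF V2] by blast
  \<comment> \<open>The first entry lets the quadratic error be absorbed; the second keeps
    \<open>t *\<^sub>R d k\<close> within radius \<open>r\<close>, given
    \<open>norm (d k) \<le> \<bar>B\<bar> / a\<close>.\<close>
  define m where "m = min ((1 - \<sigma>) * a / \<kappa>) (r / (\<bar>B\<bar> / a + 1))"
  have den: "0 < \<bar>B\<bar> / a + 1"
    using a by (simp add: add_nonneg_pos)
  have m: "0 < m"
    unfolding m_def using \<sigma> a \<open>0 < \<kappa>\<close> \<open>0 < r\<close> den by (simp add: divide_pos_pos)
  show ?thesis
  proof
    show "0 < min \<tau>min (\<beta> * m)"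
      using \<tau>min \<beta> m by simp
    show "0 < min e1 e2"
      using e1 e2 by simp
    fix k assume k: "norm (x k - xs) < min e1 e2"
    have V: "x k \<in> V1" "x k \<in> V2"
      using k e1 e2 x_in_M by auto
    let ?accept = "\<lambda>t. \<phi> (R (x k) (t *\<^sub>R d k)) \<le> Ref k + \<sigma> * t * (w k \<bullet> d k)"
    have accept: "?accept t" if "0 < t" "t \<le> m" for t
    proof -
      have "norm (d k) \<le> \<bar>B\<bar> / a"
        using norm_d[of k] B[OF V(1) w_proj] a by (simp add: field_simps)
      then have "t * norm (d k) \<le> r / (\<bar>B\<bar> / a + 1) * (\<bar>B\<bar> / a + 1)"
        using that den \<open>0 < r\<close> by (intro mult_mono) (auto simp: m_def)
      then have "norm (t *\<^sub>R d k) \<le> r"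
        using den that by simp
      then have q: "\<phi> (R (x k) (t *\<^sub>R d k)) \<le> \<phi> (x k) + t * (w k \<bullet> d k) + \<kappa> * (t\<^sup>2 * (norm (d k))\<^sup>2)"
        using quad[rule_format, OF V(2) tangent_space_scaleR[OF d_tangent] _ w_proj, of t]
        by (simp add: power_mult_distrib)
      have "\<kappa> * t \<le> (1 - \<sigma>) * a"
        using that \<open>0 < \<kappa>\<close> by (simp add: m_def field_simps)
      then have "(\<kappa> * t) * (t * (norm (d k))\<^sup>2) \<le> ((1 - \<sigma>) * a) * (t * (norm (d k))\<^sup>2)"
        using that by (intro mult_right_mono) auto
      moreover have "(1 - \<sigma>) * t * (w k \<bullet> d k) \<le> (1 - \<sigma>) * t * (- a * (norm (d k))\<^sup>2)"
        using w_d[of k] \<sigma> that by (intro mult_left_mono) auto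
      ultimately have "\<kappa> * (t\<^sup>2 * (norm (d k))\<^sup>2) + (1 - \<sigma>) * t * (w k \<bullet> d k) \<le> 0"
        by (simp add: power2_eq_square algebra_simps)
      then show ?thesis
        using q \<phi>_le_Ref[of k] by (simp add: algebra_simps)
    qed
    obtain t0 j where t: "t0 \<in> {\<tau>min..\<tau>max}" "\<tau> k = \<beta> ^ j * t0" "\<And>i. i < j \<Longrightarrow> \<not> ?accept (\<beta> ^ i * t0)"
      using backtracking[of k] unfolding backtracking_step_def by blast
    show "min \<tau>min (\<beta> * m) \<le> \<tau> k"
    proof (cases j)
      case 0
      then show ?thesis
        using t by (simp add: min_le_iff_disj)
    next
      case (Suc i)
      have "0 < \<beta> ^ i * t0"
        using \<beta> t(1) \<tau>min by simp
      then have "m < \<beta> ^ i * t0"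
        using t(3)[of i] accept Suc by force
      then have "\<beta> * m \<le> \<beta> * (\<beta> ^ i * t0)"
        using \<beta> by (intro mult_left_mono) auto
      then show ?thesis
        using t(2) Suc by (simp add: mult.assoc)
    qed
  qed
qed

text \<open>Solving the averaging identity for the new gap, with the function gap bounded by half of
  it, gives the factor (1 - p) / (1 - p/2) for the weight p, and this is at most 1 - p/2.\<close>

lemma stall:
  assumes "\<phi> (x (Suc k)) - \<phi> xs \<le> (Ref (Suc k) - \<phi> xs) / 2"
  shows "Ref (Suc k) - \<phi> xs \<le> (1 - pmin / 2) * (Ref k - \<phi> xs)"
proof -
  let ?D = "Ref k - \<phi> xs" and ?D' = "Ref (Suc k) - \<phi> xs" and ?p = "p (Suc k)"
  have p: "pmin \<le> ?p" "?p \<le> 1" "0 < ?p"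
    using p[of k] pmin by auto
  have D: "0 \<le> ?D"
    using Ref_ge[of k] by simp
  have "?D' = (1 - ?p) * ?D + ?p * (\<phi> (x (Suc k)) - \<phi> xs)"
    by (simp add: Ref_Suc algebra_simps)
  also have "\<dots> \<le> (1 - ?p) * ?D + ?p * (?D' / 2)"
    using assms p by (intro add_left_mono mult_left_mono) auto
  finally have "(1 - ?p / 2) * ?D' \<le> (1 - ?p) * ?D"
    by (simp add: algebra_simps)
  also have "(1 - ?p) * ?D \<le> (1 - ?p / 2)\<^sup>2 * ?D"
    using D by (intro mult_right_mono) (auto simp: power2_eq_square algebra_simps)
  finally have "(1 - ?p / 2) * ?D' \<le> (1 - ?p / 2) * ((1 - ?p / 2) * ?D)"
    by (simp add: power2_eq_square mult.assoc)
  then have "?D' \<le> (1 - ?p / 2) * ?D"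
    using p by (subst (asm) mult_le_cancel_left_pos) auto
  also have "\<dots> \<le> (1 - pmin / 2) * ?D"
    using p D by (intro mult_right_mono) auto
  finally show ?thesis .
qed

text \<open>\<open>stepsize_lower_bound\<close> turns the decrease of \<open>Ref\<close> into one by
  the squared length of \<open>d k\<close>; \<open>step_lim\<close> brings the tangent steps
  eventually into the range of the retraction bound.\<close>

lemma descent_locale:
  obtains L c e where "nonmonotone_descent x xs K (\<lambda>k. Ref k - \<phi> xs) (\<lambda>k. \<phi> (x k) - \<phi> xs)
    (\<lambda>k. norm (d k)) L c (1 - pmin / 2) e b"
proof -
  obtain \<tau>low e1 where \<tau>low: "0 < \<tau>low" "0 < e1" "\<And>k. norm (x k - xs) < e1 \<Longrightarrow> \<tau>low \<le> \<tau> k"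
    using stepsize_lower_bound by metis
  obtain L e2 where L: "0 < L" "0 < e2"
    "\<And>y \<xi>. y \<in> M \<Longrightarrow> \<xi> \<in> tangent_space M y \<Longrightarrow> norm (y - xs) < e2 \<Longrightarrow> norm \<xi> < e2 \<Longrightarrow>
       norm (R y \<xi> - y) \<le> L * norm \<xi>"
    using retraction_norm_bound[OF submanifold retraction xs] by metis
  have "nonmonotone_descent x xs K (\<lambda>k. Ref k - \<phi> xs) (\<lambda>k. \<phi> (x k) - \<phi> xs)
    (\<lambda>k. norm (d k)) (L * \<tau>max) (pmin * \<sigma> * a * \<tau>low) (1 - pmin / 2) (min e1 e2) b"
  proof
    show "0 < Ref k - \<phi> xs" for k
      using Ref_ge[of "Suc k"] Ref_strict[of k] by simp
    show "(\<lambda>k. Ref k - \<phi> xs) \<longlonglongrightarrow> 0"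
      using Ref_lim by (simp add: LIM_zero)
    show "\<forall>\<^sub>F k in sequentially. norm (x k - xs) < min e1 e2 \<longrightarrow>
        pmin * \<sigma> * a * \<tau>low * (norm (d k))\<^sup>2 \<le> Ref k - \<phi> xs - (Ref (Suc k) - \<phi> xs)"
    proof (intro always_eventually allI impI)
      fix k assume "norm (x k - xs) < min e1 e2"
      then have "pmin * \<sigma> * a * (\<tau>low * (norm (d k))\<^sup>2) \<le> pmin * \<sigma> * a * (\<tau> k * (norm (d k))\<^sup>2)"
        using \<tau>low(3) pmin \<sigma> a by (intro mult_left_mono mult_right_mono) auto
      then show "pmin * \<sigma> * a * \<tau>low * (norm (d k))\<^sup>2 \<le> Ref k - \<phi> xs - (Ref (Suc k) - \<phi> xs)"
        using Ref_decrease[of k] by (simp add: mult.assoc)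
    qed
    have "\<forall>\<^sub>F k in sequentially. norm (\<tau> k *\<^sub>R d k) < e2"
      using step_lim L(2) by (rule order_tendstoD)
    then show "\<forall>\<^sub>F k in sequentially. norm (x k - xs) < min e1 e2 \<longrightarrow>
        norm (x (Suc k) - x k) \<le> L * \<tau>max * norm (d k)"
    proof (eventually_elim, intro impI)
      fix k assume "norm (\<tau> k *\<^sub>R d k) < e2" "norm (x k - xs) < min e1 e2"
      then have "norm (x (Suc k) - x k) \<le> L * norm (\<tau> k *\<^sub>R d k)"
        unfolding x_Suc using x_in_M tangent_space_scaleR[OF d_tangent] by (intro L(3)) auto
      also have "\<dots> = L * (\<tau> k * norm (d k))"
        using \<tau>_bounds(1)[of k] by simp
      also have "\<dots> \<le> L * (\<tau>max * norm (d k))"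
        using \<tau>_bounds[of k] L(1) by (intro mult_left_mono mult_right_mono) auto
      finally show "norm (x (Suc k) - x k) \<le> L * \<tau>max * norm (d k)"
        by (simp only: mult.assoc)
    qed
    show "Ref (Suc k) - \<phi> xs \<le> Ref k - \<phi> xs" for k
      using Ref_strict[of k] by simp
    show "0 < L * \<tau>max"
      using L(1) \<tau>_bounds[of 0] by simp
    show "0 < pmin * \<sigma> * a * \<tau>low"
      using pmin \<sigma> a \<tau>low(1) by simp
  qed (use pmin \<tau>low L b \<phi>_le_Ref stall K lim_K in auto)
  then show ?thesis
    using that by blast
qed

text \<open>\<open>w k\<close> is a limiting subgradient of norm at most
  \<open>b * norm (d k)\<close>, so this product may replace the distance in the KL inequality. The
  rest unpacks \<open>KL_with\<close> into real-valued facts.\<close>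

lemma KL_along_run:
  assumes "KL_with (extend_by_infty M \<phi>) xs \<psi>"
  obtains \<eta> e \<psi>' where "0 < \<eta>" "0 < e" "continuous_on {0..\<eta>} \<psi>" "concave_on {0..\<eta>} \<psi>"
    "\<And>t. t \<in> {0..\<eta>} \<Longrightarrow> 0 \<le> \<psi> t" "\<psi> 0 = 0"
    "\<And>t. t \<in> {0<..<\<eta>} \<Longrightarrow> (\<psi> has_real_derivative \<psi>' t) (at t)" "\<And>t. t \<in> {0<..<\<eta>} \<Longrightarrow> 0 < \<psi>' t"
    "\<And>k. norm (x k - xs) < e \<Longrightarrow> 0 < \<phi> (x k) - \<phi> xs \<Longrightarrow> \<phi> (x k) - \<phi> xs < \<eta> \<Longrightarrow>
      1 \<le> \<psi>' (\<phi> (x k) - \<phi> xs) * (b * norm (d k))"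
proof -
  let ?g = "extend_by_infty M \<phi>"
  obtain \<eta> U \<psi>' where \<eta>: "0 < \<eta>" and U: "open U" "xs \<in> U"
    and \<psi>: "continuous_on {0..\<eta>} \<psi>" "concave_on {0..\<eta>} \<psi>" "\<forall>t\<in>{0..\<eta>}. 0 \<le> \<psi> t" "\<psi> 0 = 0"
    and \<psi>': "\<forall>t\<in>{0<..<\<eta>}. (\<psi> has_real_derivative \<psi>' t) (at t) \<and> 0 < \<psi>' t"
    and KL: "\<And>y. y \<in> U \<Longrightarrow> ?g xs < ?g y \<Longrightarrow> ?g y < ?g xs + ereal \<eta> \<Longrightarrow>
       1 \<le> ereal (\<psi>' (real_of_ereal (?g y - ?g xs))) * set_dist 0 (limiting_subdifferential ?g y)"
    using assms unfolding KL_with_def by blast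
  obtain e where e: "0 < e" "ball xs e \<subseteq> U"
    using U open_contains_ball by blast
  have KLk: "1 \<le> \<psi>' (\<phi> (x k) - \<phi> xs) * (b * norm (d k))"
    if near: "norm (x k - xs) < e" and r: "0 < \<phi> (x k) - \<phi> xs" "\<phi> (x k) - \<phi> xs < \<eta>" for k
  proof -
    have pos: "0 < \<psi>' (\<phi> (x k) - \<phi> xs)"
      using \<psi>' r by simp
    have "x k \<in> U"
      using e near by (auto simp: dist_norm norm_minus_commute)
    then have "1 \<le> ereal (\<psi>' (\<phi> (x k) - \<phi> xs)) * set_dist 0 (limiting_subdifferential ?g (x k))"
      using KL[of "x k"] r xs x_in_M by (simp add: extend_by_infty_eq)
    also have "set_dist 0 (limiting_subdifferential ?g (x k)) \<le> ereal (norm (0 - w k))"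
      unfolding set_dist_def
      using proj_subdifferential_subset_limiting[OF submanifold x_in_M] w_proj by (intro INF_lower) blast
    also have "ereal (norm (0 - w k)) \<le> ereal (b * norm (d k))"
      using norm_w by simp
    finally show ?thesis
      using pos by (simp add: ereal_mult_left_mono one_ereal_def)
  qed
  show ?thesis
    by (rule that[OF \<eta> e(1) \<psi>(1,2) _ \<psi>(4) _ _ KLk]) (use \<psi>(3) \<psi>' in auto)
qed

end

section \<open>Convergence of the method and its rates\<close>

theorem theorem4p5:
  fixes M :: "'a::euclidean_space set"
    and R :: "'a \<Rightarrow> 'a \<Rightarrow> 'a"
    and \<phi> :: "'a \<Rightarrow> real"
    and x w d :: "nat \<Rightarrow> 'a"
    and \<tau> p Ref :: "nat \<Rightarrow> real"
    and \<tau>min \<tau>max \<sigma> \<beta> pmin a b :: real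
    and xs :: 'a and K :: "nat \<Rightarrow> nat"
  assumes "embedded_submanifold M"
    and "manifold_retraction M R"
    and "continuous_on M \<phi>"
    and "locally_bounded_on M (proj_subdifferential M \<phi>)"
    and "\<forall>xb\<in>M. \<exists>\<kappa>>0. \<exists>r>0. \<exists>V. openin (top_of_set M) V \<and> xb \<in> V \<and>
           (\<forall>y\<in>V. \<forall>\<xi>\<in>tangent_space M y. norm \<xi> \<le> r \<longrightarrow>
             (\<forall>v\<in>proj_subdifferential M \<phi> y.
                \<phi> (R y \<xi>) - (\<phi> y + v \<bullet> \<xi>) \<le> \<kappa> * (norm \<xi>)\<^sup>2))"
    and "0 < \<tau>min" and "\<tau>min \<le> \<tau>max"
    and "\<sigma> \<in> {0<..<1}" and "\<beta> \<in> {0<..<1}" and "pmin \<in> {0<..1}"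
    and "0 < a" and "0 < b"
    and "nonmonotone_subgradient_run M R \<phi> \<tau>min \<tau>max \<sigma> \<beta> pmin a b x w d \<tau> p Ref"
    and "strict_mono K" and "(\<lambda>i. x (K i)) \<longlonglongrightarrow> xs" and "xs \<in> M"
    and "KL_property (extend_by_infty M \<phi>) xs"
  shows "x \<longlonglongrightarrow> xs \<and>
    (\<forall>c \<theta>. 0 < c \<and> \<theta> \<in> {0<..<1} \<and>
        KL_with (extend_by_infty M \<phi>) xs (\<lambda>t. c * t powr \<theta>) \<longrightarrow>
      (\<theta> \<in> {1/2..<1} \<longrightarrow> R_linear Ref (\<phi> xs) \<and> R_linear x xs) \<and>
      (\<theta> \<in> {0<..<1/2} \<longrightarrow>
        (\<exists>\<eta>1>0. \<exists>\<eta>2>0. \<forall>\<^sub>F k in sequentially.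
           Ref k - \<phi> xs \<le> \<eta>1 * real k powr (- (1 / (1 - 2 * \<theta>))) \<and>
           norm (x k - xs) \<le> \<eta>2 * real k powr (- (\<theta> / (1 - 2 * \<theta>))))))"
proof -
  interpret run: nonmonotone_subgradient_method M R \<phi> x w d \<tau> p Ref \<tau>min \<tau>max \<sigma> \<beta> pmin a b xs K
    using assms by unfold_locales
  obtain L c0 e where "nonmonotone_descent x xs K (\<lambda>k. Ref k - \<phi> xs) (\<lambda>k. \<phi> (x k) - \<phi> xs)
      (\<lambda>k. norm (d k)) L c0 (1 - pmin / 2) e b"
    using run.descent_locale by blast
  then interpret nonmonotone_descent x xs K "\<lambda>k. Ref k - \<phi> xs" "\<lambda>k. \<phi> (x k) - \<phi> xs"
      "\<lambda>k. norm (d k)" L c0 "1 - pmin / 2" e b .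
  \<comment> \<open>Any desingularization function suffices for convergence; the rates start afresh
    from the KL data of the power function.\<close>
  obtain \<psi> where "KL_with (extend_by_infty M \<phi>) xs \<psi>"
    using assms(17) by (auto simp: KL_property_def)
  then have lim: "x \<longlonglongrightarrow> xs"
    by (rule run.KL_along_run) (rule path_length)
  show ?thesis
  proof (intro conjI allI impI)
    show "x \<longlonglongrightarrow> xs" by (fact lim)
  next
    fix c \<theta> :: real
    assume "0 < c \<and> \<theta> \<in> {0<..<1} \<and> KL_with (extend_by_infty M \<phi>) xs (\<lambda>t. c * t powr \<theta>)"
    then have c: "0 < c" and \<theta>: "0 < \<theta>" "\<theta> < 1"
      and "KL_with (extend_by_infty M \<phi>) xs (\<lambda>t. c * t powr \<theta>)"
      by auto
    let ?\<psi> = "\<lambda>t. c * t powr \<theta>"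
    from \<open>KL_with _ _ ?\<psi>\<close> obtain \<eta> e' \<psi>' where \<eta>: "0 < \<eta>" and e': "0 < e'"
      and \<psi>: "continuous_on {0..\<eta>} ?\<psi>" "concave_on {0..\<eta>} ?\<psi>"
        "\<And>t. t \<in> {0..\<eta>} \<Longrightarrow> 0 \<le> ?\<psi> t" "?\<psi> 0 = 0"
      and deriv: "\<And>t. t \<in> {0<..<\<eta>} \<Longrightarrow> (?\<psi> has_real_derivative \<psi>' t) (at t)"
        "\<And>t. t \<in> {0<..<\<eta>} \<Longrightarrow> 0 < \<psi>' t"
      and KL: "\<And>k. norm (x k - xs) < e' \<Longrightarrow> 0 < \<phi> (x k) - \<phi> xs \<Longrightarrow> \<phi> (x k) - \<phi> xs < \<eta> \<Longrightarrow>
        1 \<le> \<psi>' (\<phi> (x k) - \<phi> xs) * (b * norm (d k))"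
      by (rule run.KL_along_run) blast
    \<comment> \<open>\<open>KL_with\<close> only asserts that some derivative exists; uniqueness
      identifies it with that of the power function, so the constant \<open>C\<close> becomes
      \<open>c * \<theta>\<close>.\<close>
    have \<psi>'_eq: "\<psi>' t = c * \<theta> * t powr (\<theta> - 1)" if "t \<in> {0<..<\<eta>}" for t
    proof -
      have "(?\<psi> has_real_derivative c * (\<theta> * t powr (\<theta> - 1))) (at t)"
        using that by (intro DERIV_cmult has_real_derivative_powr) auto
      then show ?thesis
        using DERIV_unique[OF deriv(1)[OF that]] by simp
    qed
    obtain \<kappa> where \<kappa>: "0 < \<kappa>"
      and alt: "\<forall>\<^sub>F k in sequentially. Ref (Suc k) - \<phi> xs \<le> (1 - pmin / 2) * (Ref k - \<phi> xs) \<or>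
        \<kappa> * (Ref (Suc k) - \<phi> xs) powr (2 * (1 - \<theta>)) \<le> Ref (Suc k) - \<phi> xs - (Ref (Suc (Suc k)) - \<phi> xs)"
    proof (rule power_alternative[OF \<eta> e' _ \<theta> _ lim])
      show "0 < c * \<theta>"
        using c \<theta> by simp
      show "1 \<le> c * \<theta> * (\<phi> (x k) - \<phi> xs) powr (\<theta> - 1) * (b * norm (d k))"
        if "norm (x k - xs) < e'" "0 < \<phi> (x k) - \<phi> xs" "\<phi> (x k) - \<phi> xs < \<eta>" for k
        using KL[OF that] \<psi>'_eq[of "\<phi> (x k) - \<phi> xs"] that by simp
    qed
    \<comment> \<open>A second use of \<open>path_length\<close>, now for its quantitative
      bound.\<close>
    obtain A B where AB: "0 \<le> A" "0 \<le> B"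
      and "\<forall>\<^sub>F k in sequentially. norm (x k - xs) \<le>
        A * sqrt (Ref (k - 1) - \<phi> xs) + B * (c * ((Ref k - \<phi> xs) / 2) powr \<theta>)"
      by (rule path_length[OF \<eta> e' \<psi> deriv KL])
    from iterate_bound[OF AB c \<theta>(1) this(3)] have bound: "\<forall>\<^sub>F k in sequentially.
        norm (x k - xs) \<le> (A + B * c) * (Ref (k - 1) - \<phi> xs) powr min (1/2) \<theta>" .
    have AB': "0 \<le> A + B * c"
      using AB c by simp
    \<comment> \<open>\<open>R_linear\<close> of the gap towards 0 and of \<open>Ref\<close> towards
      \<open>\<phi> xs\<close> unfold to the same limit superior.\<close>
    show "R_linear Ref (\<phi> xs)" "R_linear x xs" if "\<theta> \<in> {1/2..<1}"
      using linear_rate[OF \<kappa> _ AB' alt bound] that by (auto simp: R_linear_def)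
    show "\<exists>\<eta>1>0. \<exists>\<eta>2>0. \<forall>\<^sub>F k in sequentially.
           Ref k - \<phi> xs \<le> \<eta>1 * real k powr (- (1 / (1 - 2 * \<theta>))) \<and>
           norm (x k - xs) \<le> \<eta>2 * real k powr (- (\<theta> / (1 - 2 * \<theta>)))" if "\<theta> \<in> {0<..<1/2}"
      using sublinear_rate[OF \<kappa> \<theta>(1) _ AB' alt bound] that by auto
  qed
qed

end
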